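(* Let $p>3$ be a prime. Then (i) $\displaystyle\sum_{k=1}^{p-1}\frac{\binom{2k}k\binom{3k}k}{27^kk}\equiv 3q_p(3)-\frac 32pq_p(3)^2+p^2q_p(3)^3+\frac{52}{27}p^2B_{p-3}\pmod{p^3}$; (ii) $\displaystyle\sum_{k=1}^{p-1}\frac{\binom{2k}k\binom{4k}{2k}}{64^kk}\equiv 6q_p(2)-3pq_p(2)^2+2p^2q_p(2)^3+\frac 72p^2B_{p-3}\pmod{p^3}$; (iii) $\displaystyle\sum_{k=1}^{p-1}\frac{\binom{6k}{3k}\binom{3k}k}{432^kk}\equiv 4q_p(2)+3q_p(3)-p\Big(2q_p(2)^2+\frac 32q_p(3)^2\Big)+p^2\Big(\frac 43q_p(2)^3+q_p(3)^3\Big)+\frac{455}{54}p^2B_{p-3}\pmod{p^3}$.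
   Context: For $x,y\in\mathbb Q$ with denominators prime to $p$, $x\equiv y\pmod{p^m}$ means $(x-y)/p^m$ has denominator prime to $p$. For an integer $a$ not divisible by $p$, $q_p(a)=(a^{p-1}-1)/p$ is the Fermat quotient. The Bernoulli numbers are defined by $B_0=1$ and $\sum_{k=0}^{n-1}\binom nkB_k=0$ for $n\ge2$. *)

theory Defs
  imports Complex_Main "HOL-Computational_Algebra.Primes"
begin

definition p_integral :: "nat \<Rightarrow> rat \<Rightarrow> bool" where
  "p_integral p x \<longleftrightarrow> coprime (snd (quotient_of x)) (int p)"

text \<open>The congruence is only meaningful for rationals with denominators prime to \<open>p\<close>;
  here that is part of what it asserts.\<close>

definition rat_cong :: "nat \<Rightarrow> nat \<Rightarrow> rat \<Rightarrow> rat \<Rightarrow> bool" where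
  "rat_cong p m x y \<longleftrightarrow>
     p_integral p x \<and> p_integral p y \<and> p_integral p ((x - y) / of_nat p ^ m)"

definition fermat_quotient :: "nat \<Rightarrow> int \<Rightarrow> rat" where
  "fermat_quotient p a = (of_int a ^ (p - 1) - 1) / of_nat p"

text \<open>The defining recurrence \<open>(\<Sum>k<n. (n choose k) * B k) = 0\<close> for \<open>n \<ge> 2\<close>,
  solved for its last term; thus \<open>B 1 = - 1 / 2\<close>.\<close>

fun bernoulli :: "nat \<Rightarrow> rat" where
  "bernoulli 0 = 1"
| "bernoulli (Suc n) =
     - (\<Sum>k\<le>n. of_nat ((n + 2) choose k) * bernoulli k) / of_nat (n + 2)"

lemma bernoulli_recurrence:
  assumes "n \<ge> 2"
  shows "(\<Sum>k<n. of_nat (n choose k) * bernoulli k) = 0"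
proof -
  obtain m where n: "n = Suc (Suc m)"
    using assms by (metis Suc_le_D numeral_2_eq_2 Suc_le_mono)
  have "(of_nat (m + 2) :: rat) \<noteq> 0"
    by (simp only: of_nat_eq_0_iff)
  moreover have "n choose Suc m = m + 2"
    by (simp add: n)
  ultimately show ?thesis
    by (simp only: n sum.lessThan_Suc bernoulli.simps lessThan_Suc_atMost [symmetric]) simp
qed

end

(*
Let a = -1/m. The k-th summand is w(a, k) / k with w(a, k) = C(a, k) C(-1-a, k), and the sum
f(a) of these over 0 < k < p satisfies f(a) - f(a-1) = (2/a) (G(a) - 1), where G(a) is the
product of 1 - a^2/j^2 over 0 < j < p.  Put t = -1/m.  Going from a = p t up by p div m unit
steps one arrives at -(p mod m)/m, which for m = 3, 4, 6 is -1/m up to the symmetry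
a -> -1-a of f.  Along the way G(a) is congruent to p^2 t (t+1) / a^2 modulo p^3, so f(-1/m)
becomes a combination of the sums A(j, s) of 1/r^s over 0 < r < p with r = -p j (mod m),
where j = m - 1.

These sums satisfy linear relations modulo p^3: the reflection r -> p - r, the bijection
x = (r + p j) / m of the residue classes onto 1, ..., p - 1 (applied to the sum of 1/x^2 and,
after taking logarithms, to the product of the x, which produces the Fermat quotient of m),
and the refinement of classes from a divisor of m to m.  For m = 3, 4, 6 the relations
determine f(-1/m) in terms of Fermat quotients and the sum H of 1/x^2, which is congruent to
(2/3) p B_(p-3) modulo p^2.
*)

theory Submission
  imports Defs "HOL-Number_Theory.Cong"
begin

text \<open>The right-hand sides are truncated logarithms: with q = q_p(m), the expression q - p q^2
  / 2 + p^2 q^3 / 3 agrees modulo p^3 with log(m^(p-1)) / p. So each claim writes f(-1/m) as an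
  integer combination of the logarithms belonging to 2 and 3, plus a rational multiple of H. At a =
  p t the sum f can be evaluated directly, because every w(p t, k) has a factor p. All later a are
  units at p; for such a two factors of G(a) vanish modulo p, so only a leading term survives modulo
  p^3, and it is transported from a = p t by unit steps. The values m = 3, 4, 6 are those with
  exactly two residue classes prime to m; hence p is 1 or -1 modulo m. They also have as many
  divisors greater than 1 as reflection leaves independent sums of 1/r: one, two and three. Each
  such divisor contributes a logarithm relation, which ties these sums down, and a relation for the
  sums of 1/r^3; the sums of 1/r^2 enter the outcome only through their total H.\<close>

section \<open>Rationals with denominator prime to p\<close>

lemma p_integral_iff:
  assumes "prime p"
  shows "p_integral p x \<longleftrightarrow> (\<exists>a b. \<not> int p dvd b \<and> x = of_int a / of_int b)"
proof
  assume x: "p_integral p x"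
  obtain a b where ab: "quotient_of x = (a, b)"
    by (cases "quotient_of x")
  have "coprime b (int p)"
    using x ab by (simp add: p_integral_def)
  then have "\<not> int p dvd b"
    using assms by (metis coprime_commute coprime_absorb_left not_prime_unit prime_nat_int_transfer)
  then show "\<exists>a b. \<not> int p dvd b \<and> x = of_int a / of_int b"
    using quotient_of_div [OF ab] by blast
next
  assume "\<exists>a b. \<not> int p dvd b \<and> x = of_int a / of_int b"
  then obtain a b where b: "\<not> int p dvd b" and x: "x = of_int a / of_int b"
    by blast
  obtain c d where cd: "quotient_of x = (c, d)"
    by (cases "quotient_of x")
  have "d > 0" "coprime c d"
    using quotient_of_denom_pos [OF cd] quotient_of_coprime [OF cd] by auto
  have "b \<noteq> 0"
    using b by auto
  have "of_int (c * b) = (of_int (a * d) :: rat)"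
    using quotient_of_div [OF cd] x \<open>d > 0\<close> \<open>b \<noteq> 0\<close> by (simp add: field_simps)
  then have "c * b = a * d"
    by (simp only: of_int_eq_iff)
  then have "d dvd c * b"
    by simp
  then have "d dvd b"
    using \<open>coprime c d\<close> by (simp add: coprime_commute coprime_dvd_mult_right_iff)
  then have "\<not> int p dvd d"
    using b dvd_trans by blast
  then have "coprime (int p) d"
    using assms by (simp add: prime_imp_coprime)
  then show "p_integral p x"
    by (simp add: p_integral_def cd coprime_commute)
qed

lemma p_integral_add:
  assumes "prime p" "p_integral p x" "p_integral p y"
  shows "p_integral p (x + y)"
proof -
  obtain a b c d where *: "\<not> int p dvd b" "x = of_int a / of_int b"
      "\<not> int p dvd d" "y = of_int c / of_int d"
    using assms by (metis p_integral_iff)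
  have "\<not> int p dvd b * d"
    using * assms(1) by (simp add: prime_dvd_mult_iff)
  moreover have "x + y = of_int (a * d + c * b) / of_int (b * d)"
    using * by (cases "b = 0"; cases "d = 0") (auto simp: field_simps)
  ultimately show ?thesis
    using assms(1) p_integral_iff by blast
qed

lemma p_integral_mult:
  assumes "prime p" "p_integral p x" "p_integral p y"
  shows "p_integral p (x * y)"
proof -
  obtain a b c d where *: "\<not> int p dvd b" "x = of_int a / of_int b"
      "\<not> int p dvd d" "y = of_int c / of_int d"
    using assms by (metis p_integral_iff)
  have "\<not> int p dvd b * d"
    using * assms(1) by (simp add: prime_dvd_mult_iff)
  moreover have "x * y = of_int (a * c) / of_int (b * d)"
    using * by (auto simp: field_simps)
  ultimately show ?thesis
    using assms(1) p_integral_iff by blast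
qed

section \<open>Hypergeometric sums and their difference equation in a\<close>

text \<open>This is C(a, k) C(-1-a, k) with the signs of the two binomial coefficients cancelled;
  the symmetry a -> -1-a then swaps the two factors of each numerator.\<close>

definition hyp_coeff :: "rat \<Rightarrow> nat \<Rightarrow> rat" where
  "hyp_coeff a k = (\<Prod>j = 1..k. (of_nat j - 1 - a) * (of_nat j + a) / of_nat j ^ 2)"

definition hyp_sum :: "nat \<Rightarrow> rat \<Rightarrow> rat" where
  "hyp_sum n a = (\<Sum>k = 1..n. hyp_coeff a k / of_nat k)"

text \<open>Up to the factor \<open>\<pi> * a\<close>, the \<open>n\<close>-th partial product of Euler's product for
  \<open>sin (\<pi> * a)\<close>.\<close>

definition sin_prod :: "rat \<Rightarrow> nat \<Rightarrow> rat" where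
  "sin_prod a n = (\<Prod>j = 1..n. 1 - a ^ 2 / of_nat j ^ 2)"

lemma hyp_coeff_0 [simp]: "hyp_coeff a 0 = 1"
  by (simp add: hyp_coeff_def)

lemma hyp_coeff_Suc:
  "hyp_coeff a (Suc k) = hyp_coeff a k * ((of_nat k - a) * (of_nat (Suc k) + a) / of_nat (Suc k) ^ 2)"
  by (simp add: hyp_coeff_def)

lemma sin_prod_0 [simp]: "sin_prod a 0 = 1"
  by (simp add: sin_prod_def)

lemma sin_prod_Suc: "sin_prod a (Suc n) = sin_prod a n * (1 - a ^ 2 / of_nat (Suc n) ^ 2)"
  by (simp add: sin_prod_def)

lemma hyp_coeff_reflect: "hyp_coeff (- 1 - a) k = hyp_coeff a k"
  unfolding hyp_coeff_def by (rule prod.cong) (auto simp: algebra_simps)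

lemma hyp_sum_reflect: "hyp_sum n (- 1 - a) = hyp_sum n a"
  by (simp add: hyp_sum_def hyp_coeff_reflect)

text \<open>The numerators are the products of j - a over 0 \<le> j \<le> k and of j + a over 1
  \<le> j \<le> k + 1. Pairing equal j gives j^2 - a^2; the unpaired end factors are -a and k + 1 +
  a.\<close>

lemma hyp_coeff_eq_sin_prod:
  "hyp_coeff a (Suc k) = - a * (of_nat (Suc k) + a) / of_nat (Suc k) ^ 2 * sin_prod a k"
proof (induction k)
  case (Suc k)
  define n :: rat where "n = of_nat (Suc k)"
  have n: "n \<noteq> 0" "of_nat (Suc (Suc k)) = n + 1" "n + 1 \<noteq> 0"
    unfolding n_def by (simp_all add: add_nonneg_eq_0_iff)
  show ?case
    unfolding hyp_coeff_Suc [of a "Suc k"] sin_prod_Suc Suc n(2) n_def [symmetric]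
    using n(1,3) by (simp add: divide_simps) algebra
qed (simp add: hyp_coeff_Suc)

text \<open>The difference of the k-th summands is -2 a / k^2 times
  \<open>sin_prod a (k - 1)\<close>, which is 2 / a times the increment of \<open>sin_prod a\<close>
  at k, so the sum telescopes.\<close>

lemma hyp_sum_diff:
  assumes "a \<noteq> 0"
  shows "hyp_sum n a - hyp_sum n (a - 1) = 2 / a * (sin_prod a n - 1)"
proof (induction n)
  case (Suc n)
  define k :: rat where "k = of_nat (Suc n)"
  have k: "k \<noteq> 0" by (simp add: k_def)
  \<comment> \<open>Reflection replaces a - 1 by -a, where the same product formula applies and
    \<open>sin_prod\<close> is even.\<close>
  have "hyp_coeff (a - 1) (Suc n) = hyp_coeff (- a) (Suc n)"
    using hyp_coeff_reflect [of "- a"] by simp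
  also have "\<dots> = a * (k - a) / k ^ 2 * sin_prod a n"
    unfolding hyp_coeff_eq_sin_prod k_def by (simp add: sin_prod_def)
  finally have 1: "hyp_coeff (a - 1) (Suc n) = a * (k - a) / k ^ 2 * sin_prod a n" .
  have 2: "hyp_coeff a (Suc n) = - a * (k + a) / k ^ 2 * sin_prod a n"
    by (simp add: hyp_coeff_eq_sin_prod k_def)
  have "hyp_sum n a - hyp_sum n (a - 1) + (hyp_coeff a (Suc n) / k - hyp_coeff (a - 1) (Suc n) / k)
      = 2 / a * (sin_prod a n * (1 - a ^ 2 / k ^ 2) - 1)"
    unfolding Suc.IH 1 2 using k assms by (simp add: field_simps power2_eq_square)
  then show ?case
    unfolding sin_prod_Suc k_def [symmetric] by (simp add: hyp_sum_def k_def)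
qed (simp add: hyp_sum_def)

text \<open>Written as the product of (j - a)(j + a) / j^2, both sides share all but their end
  factors. The form without division keeps it valid where an end factor vanishes, notably at a =
  0.\<close>

lemma sin_prod_shift:
  "(1 + a) * (of_nat n - a) * sin_prod (a + 1) n = - a * (of_nat n + 1 + a) * sin_prod a n"
proof (induction n)
  case (Suc n)
  define k :: rat where "k = of_nat (Suc n)"
  have k: "k \<noteq> 0" "of_nat n = k - 1" by (simp_all add: k_def)
  have "(1 + a) * (k - a) * (sin_prod (a + 1) n * (1 - (a + 1) ^ 2 / k ^ 2))
      = ((1 + a) * (k - 1 - a) * sin_prod (a + 1) n) * ((k - a) * (k + 1 + a) / k ^ 2)"
    using k(1) by (simp add: divide_simps) algebra
  also have "\<dots> = (- a * (k + a) * sin_prod a n) * ((k - a) * (k + 1 + a) / k ^ 2)"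
    using Suc.IH unfolding k(2) by simp
  also have "\<dots> = - a * (k + 1 + a) * (sin_prod a n * (1 - a ^ 2 / k ^ 2))"
    using k(1) by (simp add: divide_simps) algebra
  finally show ?case
    unfolding sin_prod_Suc k_def [symmetric] .
qed simp

section \<open>The binomial products as hypergeometric coefficients\<close>

lemma fact_add_3: "fact (n + 3) = (of_nat (n + 3) * of_nat (n + 2) * of_nat (n + 1) * fact n :: rat)"
  by (simp add: numeral_eq_Suc algebra_simps)

lemma fact_add_2: "fact (n + 2) = (of_nat (n + 2) * of_nat (n + 1) * fact n :: rat)"
  by (simp add: numeral_eq_Suc algebra_simps)

text \<open>Both sides have the same ratio of consecutive terms: 27 = 3^3 turns (3k+1)(3k+2)(3k+3) /
  (k+1)^3 into (k+1/3)(k+2/3) / (k+1)^2. The bases of the next two lemmas arise likewise as 64 = 4^4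
  / 2^2 and 432 = 6^6 / (3^3 2^2).\<close>

lemma binomial_prod_3:
  "of_nat (((2 * k) choose k) * ((3 * k) choose k)) / 27 ^ k = hyp_coeff (- 1 / 3) k"
proof -
  have "of_nat (((2 * k) choose k) * ((3 * k) choose k)) = (fact (3 * k) / fact k ^ 3 :: rat)"
    using binomial_fact [of k "2 * k", where 'a = rat] binomial_fact [of k "3 * k", where 'a = rat]
    by (simp add: power3_eq_cube mult_2 [symmetric])
  moreover have "fact (3 * k) / fact k ^ 3 / 27 ^ k = hyp_coeff (- 1 / 3) k"
  proof (induction k)
    case (Suc k)
    define x g F c :: rat where defs: "x = of_nat k" "g = fact k" "F = fact (3 * k)" "c = 27 ^ k"
    have nz: "x + 1 \<noteq> 0" "g \<noteq> 0" "F \<noteq> 0" "c \<noteq> 0"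
      by (simp_all add: defs add_nonneg_eq_0_iff)
    have e: "3 * Suc k = 3 * k + 3" by simp
    have "fact (3 * Suc k) / fact (Suc k) ^ 3 / 27 ^ Suc k
        = ((3 * x + 3) * (3 * x + 2) * (3 * x + 1) / (27 * (x + 1) ^ 3)) * hyp_coeff (- 1 / 3) k"
      unfolding Suc.IH [symmetric] e fact_add_3 fact_Suc of_nat_add of_nat_mult of_nat_Suc of_nat_numeral of_nat_1
        power_Suc defs [symmetric]
      using nz by (simp add: divide_simps) algebra
    also have "((3 * x + 3) * (3 * x + 2) * (3 * x + 1) / (27 * (x + 1) ^ 3)) = (x + 1 / 3) * (x + 1 - 1 / 3) / (x + 1) ^ 2"
      using nz by (simp add: divide_simps) algebra
    finally show ?case
      unfolding hyp_coeff_Suc by (simp add: defs add.commute)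
  qed simp
  ultimately show ?thesis by simp
qed

lemma binomial_prod_4:
  "of_nat (((2 * k) choose k) * ((4 * k) choose (2 * k))) / 64 ^ k = hyp_coeff (- 1 / 4) k"
proof -
  have "of_nat (((2 * k) choose k) * ((4 * k) choose (2 * k))) = (fact (4 * k) / (fact (2 * k) * fact k ^ 2) :: rat)"
    using binomial_fact [of k "2 * k", where 'a = rat] binomial_fact [of "2 * k" "4 * k", where 'a = rat]
    by (simp add: power2_eq_square mult_2 [symmetric])
  moreover have "fact (4 * k) / (fact (2 * k) * fact k ^ 2) / 64 ^ k = hyp_coeff (- 1 / 4) k"
  proof (induction k)
    case (Suc k)
    define x g F G c :: rat where defs: "x = of_nat k" "g = fact k" "F = fact (4 * k)" "G = fact (2 * k)" "c = 64 ^ k"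
    have nz: "x + 1 \<noteq> 0" "2 * x + 1 \<noteq> 0" "g \<noteq> 0" "F \<noteq> 0" "G \<noteq> 0" "c \<noteq> 0"
      by (simp_all add: defs add_nonneg_eq_0_iff)
    have e: "4 * Suc k = (4 * k + 2) + 2" "2 * Suc k = 2 * k + 2" by simp_all
    have "fact (4 * Suc k) / (fact (2 * Suc k) * fact (Suc k) ^ 2) / 64 ^ Suc k
        = ((4 * x + 4) * (4 * x + 3) * (4 * x + 2) * (4 * x + 1)
        / (64 * (2 * x + 2) * (2 * x + 1) * (x + 1) ^ 2))
        * hyp_coeff (- 1 / 4) k"
      unfolding Suc.IH [symmetric] e fact_add_2 fact_Suc of_nat_add of_nat_mult of_nat_Suc of_nat_numeral of_nat_1
        power_Suc defs [symmetric]
      using nz by (simp add: divide_simps) algebra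
    also have "((4 * x + 4) * (4 * x + 3) * (4 * x + 2) * (4 * x + 1)
        / (64 * (2 * x + 2) * (2 * x + 1) * (x + 1) ^ 2))
        = (x + 1 / 4) * (x + 1 - 1 / 4) / (x + 1) ^ 2"
      using nz by (simp add: divide_simps) algebra
    finally show ?case
      unfolding hyp_coeff_Suc by (simp add: defs add.commute)
  qed simp
  ultimately show ?thesis by simp
qed

lemma binomial_prod_6:
  "of_nat (((6 * k) choose (3 * k)) * ((3 * k) choose k)) / 432 ^ k = hyp_coeff (- 1 / 6) k"
proof -
  have "of_nat (((6 * k) choose (3 * k)) * ((3 * k) choose k))
      = (fact (6 * k) / (fact (3 * k) * fact (2 * k) * fact k) :: rat)"
    using binomial_fact [of k "3 * k", where 'a = rat] binomial_fact [of "3 * k" "6 * k", where 'a = rat]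
    by simp
  moreover have "fact (6 * k) / (fact (3 * k) * fact (2 * k) * fact k) / 432 ^ k = hyp_coeff (- 1 / 6) k"
  proof (induction k)
    case (Suc k)
    define x g F G H c :: rat where defs: "x = of_nat k" "g = fact k" "F = fact (6 * k)"
        "G = fact (3 * k)" "H = fact (2 * k)" "c = 432 ^ k"
    have nz: "x + 1 \<noteq> 0" "2 * x + 1 \<noteq> 0" "3 * x + 1 \<noteq> 0" "3 * x + 2 \<noteq> 0"
        "g \<noteq> 0" "F \<noteq> 0" "G \<noteq> 0" "H \<noteq> 0" "c \<noteq> 0"
      by (simp_all add: defs add_nonneg_eq_0_iff)
    have e: "6 * Suc k = (6 * k + 3) + 3" "3 * Suc k = 3 * k + 3" "2 * Suc k = 2 * k + 2" by simp_all
    have "fact (6 * Suc k) / (fact (3 * Suc k) * fact (2 * Suc k) * fact (Suc k)) / 432 ^ Suc k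
        = ((6 * x + 6) * (6 * x + 5) * (6 * x + 4) * (6 * x + 3) * (6 * x + 2) * (6 * x + 1)
        / (432 * ((3 * x + 3) * (3 * x + 2) * (3 * x + 1)) * ((2 * x + 2) * (2 * x + 1)) * (x + 1)))
        * hyp_coeff (- 1 / 6) k"
      unfolding Suc.IH [symmetric] e fact_add_3 fact_add_2 fact_Suc of_nat_add of_nat_mult of_nat_Suc of_nat_numeral of_nat_1
        power_Suc defs [symmetric]
      using nz by (simp add: divide_simps) algebra
    also have "((6 * x + 6) * (6 * x + 5) * (6 * x + 4) * (6 * x + 3) * (6 * x + 2) * (6 * x + 1)
        / (432 * ((3 * x + 3) * (3 * x + 2) * (3 * x + 1)) * ((2 * x + 2) * (2 * x + 1)) * (x + 1)))
        = (x + 1 / 6) * (x + 1 - 1 / 6) / (x + 1) ^ 2"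
      using nz by (simp add: divide_simps) algebra
    finally show ?case
      unfolding hyp_coeff_Suc by (simp add: defs add.commute)
  qed simp
  ultimately show ?thesis by simp
qed

text \<open>Expansions of 1 / (q - x)^s in powers of q / x with exact remainders. They stop at q^3,
  q^2 and q because the sums with s = 1, 2, 3 later carry the weights 1, p, p^2.\<close>

lemma inverse_reflect:
  fixes q x :: rat
  assumes "x \<noteq> 0" "q - x \<noteq> 0"
  shows "1 / (q - x) ^ 1 + 1 / x ^ 1 + q * (1 / x ^ 2) + q ^ 2 * (1 / x ^ 3) = q ^ 3 * (1 / (x ^ 3 * (q - x)))"
    and "1 / (q - x) ^ 2 - 1 / x ^ 2 - 2 * q * (1 / x ^ 3) = q ^ 2 * ((3 * x - 2 * q) / (x ^ 3 * (q - x) ^ 2))"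
    and "1 / (q - x) ^ 3 + 1 / x ^ 3 = q * ((x ^ 2 - x * (q - x) + (q - x) ^ 2) / (x ^ 3 * (q - x) ^ 3))"
proof -
  define y where "y = q - x"
  have q: "q = x + y" and y: "y \<noteq> 0"
    using assms by (simp_all add: y_def)
  show "1 / (q - x) ^ 1 + 1 / x ^ 1 + q * (1 / x ^ 2) + q ^ 2 * (1 / x ^ 3) = q ^ 3 * (1 / (x ^ 3 * (q - x)))"
    "1 / (q - x) ^ 2 - 1 / x ^ 2 - 2 * q * (1 / x ^ 3) = q ^ 2 * ((3 * x - 2 * q) / (x ^ 3 * (q - x) ^ 2))"
    "1 / (q - x) ^ 3 + 1 / x ^ 3 = q * ((x ^ 2 - x * (q - x) + (q - x) ^ 2) / (x ^ 3 * (q - x) ^ 3))"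
    unfolding y_def [symmetric] using assms(1) y unfolding q
    by (simp_all add: field_simps power2_eq_square power3_eq_cube)
qed

section \<open>Faulhaber's formula\<close>

text \<open>The Bernoulli polynomial of degree N without its constant term, which is the summand k =
  N.\<close>

definition bernoulli_sum :: "nat \<Rightarrow> rat \<Rightarrow> rat" where
  "bernoulli_sum N x = (\<Sum>k<N. of_nat (N choose k) * bernoulli k * x ^ (N - k))"

lemma sum_triangle_swap:
  "(\<Sum>k<N. \<Sum>l<N - k. f k l) = (\<Sum>l<N. \<Sum>k<N - (l::nat). f k l :: rat)"
proof -
  have "(\<Sum>(k, l)\<in>Sigma {..<N} (\<lambda>k. {..<N - k}). f k l) = (\<Sum>(l, k)\<in>Sigma {..<N} (\<lambda>l. {..<N - l}). f k l)"
    by (rule sum.reindex_bij_witness [of _ "\<lambda>(l, k). (k, l)" "\<lambda>(k, l). (l, k)"]) auto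
  then show ?thesis
    by (simp add: sum.Sigma)
qed

lemma power_add_one_diff:
  "(x + 1) ^ n - x ^ n = (\<Sum>l<n. of_nat (n choose l) * x ^ l :: rat)"
  unfolding binomial_ring lessThan_Suc_atMost [symmetric] by simp

lemma choose_choose_swap:
  assumes "k + l \<le> n"
  shows "(n choose k) * (n - k choose l) = (n choose l) * (n - l choose k)"
proof -
  have "(k + l) choose k = (k + l) choose l"
    using binomial_symmetric [of k "k + l"] by simp
  then show ?thesis
    using choose_mult [of k "k + l" n] choose_mult [of l "k + l" n] assms by simp
qed

text \<open>After binomial expansion and exchange of the sums, the coefficient of x^l contains the
  defining recurrence of the Bernoulli numbers for N - l, which vanishes unless l = N - 1.\<close>

lemma bernoulli_sum_diff:
  assumes "N > 0"
  shows "bernoulli_sum N (x + 1) - bernoulli_sum N x = of_nat N * x ^ (N - 1)"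
proof -
  have "bernoulli_sum N (x + 1) - bernoulli_sum N x =
      (\<Sum>k<N. of_nat (N choose k) * bernoulli k * ((x + 1) ^ (N - k) - x ^ (N - k)))"
    by (simp add: bernoulli_sum_def sum_subtractf right_diff_distrib)
  also have "\<dots> = (\<Sum>k<N. \<Sum>l<N - k. of_nat ((N choose k) * (N - k choose l)) * bernoulli k * x ^ l)"
    by (simp add: power_add_one_diff sum_distrib_left mult_ac)
  also have "\<dots> = (\<Sum>l<N. \<Sum>k<N - l. of_nat ((N choose k) * (N - k choose l)) * bernoulli k * x ^ l)"
    by (rule sum_triangle_swap)
  also have "\<dots> = (\<Sum>l<N. of_nat (N choose l) * x ^ l * (\<Sum>k<N - l. of_nat (N - l choose k) * bernoulli k))"
    unfolding sum_distrib_left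
    by (intro sum.cong refl) (auto simp: choose_choose_swap mult_ac)
  also have "\<dots> = (\<Sum>l<N. if l = N - 1 then of_nat N * x ^ (N - 1) else 0)"
  proof (rule sum.cong [OF refl])
    fix l assume l: "l \<in> {..<N}"
    show "of_nat (N choose l) * x ^ l * (\<Sum>k<N - l. of_nat (N - l choose k) * bernoulli k)
        = (if l = N - 1 then of_nat N * x ^ (N - 1) else 0)"
    proof (cases "l = N - 1")
      case True
      then have "N - l = 1" "N = Suc l" using assms by auto
      then show ?thesis by simp
    next
      case False
      then show ?thesis using bernoulli_recurrence [of "N - l"] l by simp
    qed
  qed
  also have "\<dots> = of_nat N * x ^ (N - 1)"
    using assms by simp
  finally show ?thesis .
qed

lemma faulhaber:
  assumes "N > 0"
  shows "of_nat N * (\<Sum>x<n. of_nat x ^ (N - 1)) = bernoulli_sum N (of_nat n)"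
proof (induction n)
  case 0
  show ?case by (auto simp: bernoulli_sum_def intro!: sum.neutral)
next
  case (Suc n)
  then show ?case
    using bernoulli_sum_diff [OF assms, of "of_nat n"] by (simp add: algebra_simps)
qed

section \<open>Divisibility by powers of p, and units at p\<close>

locale prime_gt_3 =
  fixes p :: nat
  assumes prime_p: "prime p" and p_gt_3: "p > 3"
begin

abbreviation P :: rat where "P \<equiv> of_nat p"

text \<open>\<open>pdvd m x\<close> means that \<open>p ^ m\<close> divides \<open>x\<close> in the ring of rationals with denominators
  prime to \<open>p\<close>; in particular \<open>pdvd 0 x\<close> is membership in that ring.\<close>

definition pdvd :: "nat \<Rightarrow> rat \<Rightarrow> bool" where
  "pdvd m x \<longleftrightarrow> p_integral p (x / P ^ m)"

lemma P_nz [simp]: "P \<noteq> 0" "p \<noteq> 0"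
  using p_gt_3 by simp_all

lemma pdvd_of_int [simp]: "pdvd 0 (of_int a)"
  unfolding pdvd_def p_integral_iff [OF prime_p]
  by (rule exI [of _ a], rule exI [of _ 1]) (use prime_p in \<open>auto simp: not_prime_unit\<close>)

lemma pdvd_of_nat [simp]: "pdvd 0 (of_nat a)"
  by (metis of_int_of_nat_eq pdvd_of_int)

lemma pdvd_numeral [simp]: "pdvd 0 (numeral a)" "pdvd 0 0" "pdvd 0 1"
  by (metis of_nat_numeral pdvd_of_nat, metis of_nat_0 pdvd_of_nat, metis of_nat_1 pdvd_of_nat)

lemma pdvd_inverse_of_int: "\<not> int p dvd b \<Longrightarrow> pdvd 0 (1 / of_int b)"
  unfolding pdvd_def p_integral_iff [OF prime_p]
  by (rule exI [of _ 1], rule exI [of _ b]) auto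

lemma pdvd_add: "pdvd m x \<Longrightarrow> pdvd m y \<Longrightarrow> pdvd m (x + y)"
  by (simp add: pdvd_def add_divide_distrib p_integral_add prime_p)

lemma pdvd_mult: "pdvd m x \<Longrightarrow> pdvd n y \<Longrightarrow> pdvd (m + n) (x * y)"
  using p_integral_mult [OF prime_p, of "x / P ^ m" "y / P ^ n"]
  by (simp add: pdvd_def power_add)

lemma pdvd_mult_left: "pdvd 0 x \<Longrightarrow> pdvd m y \<Longrightarrow> pdvd m (x * y)"
  using pdvd_mult [of 0 x m y] by simp

lemma pdvd_mult_right: "pdvd m x \<Longrightarrow> pdvd 0 y \<Longrightarrow> pdvd m (x * y)"
  using pdvd_mult [of m x 0 y] by simp

lemma pdvd_minus: "pdvd m x \<Longrightarrow> pdvd m (- x)"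
  using pdvd_mult [of 0 "-1" m x] pdvd_of_int [of "-1"] by simp

lemma pdvd_diff: "pdvd m x \<Longrightarrow> pdvd m y \<Longrightarrow> pdvd m (x - y)"
  using pdvd_add [of m x "- y"] pdvd_minus by simp

lemma pdvd_zero [simp]: "pdvd m 0"
  using pdvd_numeral(2) by (simp add: pdvd_def)

lemma pdvd_sum: "(\<And>i. i \<in> S \<Longrightarrow> pdvd m (f i)) \<Longrightarrow> pdvd m (sum f S)"
  by (induction S rule: infinite_finite_induct) (auto intro: pdvd_add)

lemma pdvd_P_power_mult [simp]: "pdvd (m + n) (P ^ m * x) \<longleftrightarrow> pdvd n x"
  by (simp add: pdvd_def power_add)

lemma pdvd_P_power [simp]: "pdvd n (P ^ n)"
  using pdvd_P_power_mult [of n 0 1] by simp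

lemma pdvd_P [simp]: "pdvd 1 P"
  using pdvd_P_power [of 1] by simp

lemma pdvd_P_Suc_0 [simp]: "pdvd (Suc 0) P"
  using pdvd_P by simp

lemma pdvd_mono:
  assumes "pdvd n x" "m \<le> n"
  shows "pdvd m x"
proof -
  have "P ^ n = P ^ m * P ^ (n - m)"
    using assms(2) by (simp flip: power_add)
  then have "x / P ^ m = of_nat (p ^ (n - m)) * (x / P ^ n)"
    by simp
  moreover have "pdvd 0 (of_nat (p ^ (n - m)) * (x / P ^ n))"
    using assms(1) by (intro pdvd_mult_left pdvd_of_nat) (simp add: pdvd_def)
  ultimately show ?thesis
    by (simp add: pdvd_def)
qed

lemma pdvd_power: "pdvd m x \<Longrightarrow> pdvd (m * n) (x ^ n)"
  by (induction n) (auto intro: pdvd_mult)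

lemma pdvd_power0: "pdvd 0 x \<Longrightarrow> pdvd 0 (x ^ n)"
  using pdvd_power [of 0 x n] by simp

definition punit :: "rat \<Rightarrow> bool" where
  "punit x \<longleftrightarrow> pdvd 0 x \<and> pdvd 0 (1 / x) \<and> x \<noteq> 0"

lemma punit_imp_integral: "punit x \<Longrightarrow> pdvd 0 x"
  by (simp add: punit_def)

lemma punit_nz: "punit x \<Longrightarrow> x \<noteq> 0"
  by (simp add: punit_def)

lemma punit_mult: "punit x \<Longrightarrow> punit y \<Longrightarrow> punit (x * y)"
  using pdvd_mult_left [of x 0 y] pdvd_mult_left [of "1 / x" 0 "1 / y"] by (simp add: punit_def)

lemma pdvd_0_iff: "pdvd 0 x \<longleftrightarrow> (\<exists>a b. \<not> int p dvd b \<and> x = of_int a / of_int b)"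
  by (simp add: pdvd_def p_integral_iff [OF prime_p])

lemma pdvd_1_of_int: "pdvd 1 (of_int a) \<longleftrightarrow> int p dvd a"
proof
  assume "pdvd 1 (of_int a)"
  then obtain c d where d: "\<not> int p dvd d" and *: "of_int a / P = of_int c / of_int d"
    unfolding pdvd_def p_integral_iff [OF prime_p] by auto
  have "d \<noteq> 0" using d by auto
  then have "of_int (a * d) = (of_int (c * int p) :: rat)"
    using * by (simp add: field_simps)
  then have "a * d = c * int p"
    by (simp only: of_int_eq_iff)
  then have "int p dvd a * d" by simp
  then show "int p dvd a"
    using d prime_p by (simp add: prime_dvd_mult_iff)
next
  assume "int p dvd a"
  then obtain c where "a = int p * c" ..
  then show "pdvd 1 (of_int a)"
    using pdvd_P_power_mult [of 1 0 "of_int c"] by simp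
qed

lemma punitI:
  assumes "pdvd 0 x" "\<not> pdvd 1 x"
  shows "punit x"
proof -
  obtain a b where b: "\<not> int p dvd b" and x: "x = of_int a / of_int b"
    using assms(1) pdvd_0_iff by blast
  have "\<not> int p dvd a"
    using assms(2) pdvd_mult_right [of 1 "of_int a" "1 / of_int b"] pdvd_inverse_of_int [OF b] x
    by (auto simp: pdvd_1_of_int simp del: One_nat_def)
  moreover have "1 / x = of_int b / of_int a"
    by (simp add: x)
  ultimately show ?thesis
    using assms by (auto simp: punit_def pdvd_0_iff)
qed

lemma punit_not_pdvd:
  assumes "punit x"
  shows "\<not> pdvd 1 x"
proof
  assume "pdvd 1 x"
  then have "pdvd 1 (x * (1 / x))"
    using assms by (intro pdvd_mult_right) (auto simp: punit_def)
  then have "pdvd 1 (of_int 1)"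
    using punit_nz [OF assms] by simp
  then show False
    using prime_p unfolding pdvd_1_of_int by (simp add: not_prime_unit)
qed

lemma punit_add:
  assumes "punit x" "pdvd 1 y"
  shows "punit (x + y)"
proof (rule punitI)
  show "pdvd 0 (x + y)"
    using assms pdvd_add pdvd_mono [of 1 y 0] punit_imp_integral by simp
  show "\<not> pdvd 1 (x + y)"
    using pdvd_diff [of 1 "x + y" y] assms punit_not_pdvd by auto
qed

lemma punit_of_nat: "\<not> p dvd n \<Longrightarrow> punit (of_nat n)"
  by (rule punitI) (use pdvd_1_of_int [of "int n"] in auto)

lemma punit_of_nat_less: "0 < n \<Longrightarrow> n < p \<Longrightarrow> punit (of_nat n)"
  using punit_of_nat nat_dvd_not_less by blast

lemma punit_minus: "punit x \<Longrightarrow> punit (- x)"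
  using pdvd_minus [of 0 x] pdvd_minus [of 0 "1 / x"] by (simp add: punit_def)

lemma punit_cancel:
  assumes "punit u" "pdvd m (u * x)"
  shows "pdvd m x"
  using pdvd_mult_left [of "1 / u" m "u * x"] assms by (simp add: punit_def)

lemma pdvd_divide: "pdvd m x \<Longrightarrow> punit y \<Longrightarrow> pdvd m (x / y)"
  using pdvd_mult_right [of m x "1 / y"] by (simp add: punit_def)

lemma punit_power: "punit x \<Longrightarrow> punit (x ^ n)"
  by (induction n) (auto intro: punit_mult simp: punit_def [of 1])

lemma punit_2_3: "punit 2" "punit 3"
  using punit_of_nat_less [of 2] punit_of_nat_less [of 3] p_gt_3 by simp_all

lemma pdvd_P_mult: "pdvd m x \<Longrightarrow> pdvd (Suc m) (P * x)"
  using pdvd_mult [of 1 P m x] by simp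

lemmas pdvd_intros = pdvd_add pdvd_diff pdvd_minus pdvd_mult_left pdvd_power0

section \<open>The sine product modulo powers of p\<close>

text \<open>Every factor is 1 - p^2 t^2 / j^2 with j a unit, hence 1 modulo p^2.\<close>

lemma sin_prod_multiple:
  assumes "pdvd 0 t" "n < p"
  shows "pdvd 2 (sin_prod (P * t) n - 1)"
  using assms(2)
proof (induction n)
  case (Suc n)
  define k :: rat where "k = of_nat (Suc n)"
  have k: "punit (k ^ 2)"
    unfolding k_def using Suc.prems by (intro punit_power punit_of_nat_less) auto
  define g where "g = sin_prod (P * t) n"
  have g: "pdvd 2 (g - 1)"
    using Suc by (simp add: g_def)
  then have "pdvd 0 ((g - 1) + 1)"
    by (intro pdvd_add pdvd_mono [of 2 "g - 1" 0]) auto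
  then have "pdvd 2 (P ^ 2 * (t ^ 2 * g / k ^ 2))"
    using pdvd_P_power_mult [of 2 0 "t ^ 2 * g / k ^ 2"] k assms(1)
    by (simp add: pdvd_divide pdvd_mult_left pdvd_power0)
  then have "pdvd 2 ((g - 1) - P ^ 2 * (t ^ 2 * g / k ^ 2))"
    using g by (rule pdvd_diff [rotated])
  then show ?case
    unfolding sin_prod_Suc k_def [symmetric] g_def [symmetric]
    by (simp add: algebra_simps power_mult_distrib)
qed simp

text \<open>Telescoping \<open>sin_prod_shift\<close> from \<open>P * t\<close>: its factors are congruent to \<open>- a\<^sup>2\<close> and
  \<open>- (1 + a)\<^sup>2\<close> modulo \<open>p\<close>, except that the very first one is divisible by \<open>p\<^sup>2\<close>.\<close>

lemma sin_prod_shifted_multiple: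
  assumes t: "pdvd 0 t" and i: "0 < i" "i < p"
  defines "c \<equiv> P ^ 2 * (t * (t + 1))"
  shows "pdvd 3 ((of_nat i + P * t) ^ 2 * sin_prod (of_nat i + P * t) (p - 1) - c)"
  using i
proof (induction i)
  case (Suc i)
  define a where "a = of_nat i + P * t"
  define u where "u = 1 + a"
  define v where "v = P - 1 - a"
  define G where "G = sin_prod a (p - 1)"
  define H where "H = sin_prod (a + 1) (p - 1)"
  have P1: "of_nat (p - 1) = P - 1"
    using p_gt_3 by (simp add: of_nat_diff)
  have shift: "u * v * H = - a * (P + a) * G"
    using sin_prod_shift [of a "p - 1"] unfolding P1 u_def v_def G_def H_def by simp
  have c: "pdvd 2 c"
    unfolding c_def using pdvd_P_power_mult [of 2 0 "t * (t + 1)"] t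
    by (simp add: pdvd_mult_left pdvd_add)
  have a: "pdvd 0 a"
    unfolding a_def using t by (auto intro!: pdvd_intros)
  have "punit (- (of_nat (Suc i) + P * t) + P)"
    using Suc.prems t by (intro punit_add punit_minus punit_of_nat_less)
        (auto intro: pdvd_P_mult simp del: One_nat_def simp: pdvd_mult_right)
  then have v: "punit v"
    by (simp add: v_def a_def algebra_simps)
  have "pdvd 3 (u ^ 2 * H - c)"
  proof (cases "i = 0")
    case True
    then have a_eq: "a = P * t" by (simp add: a_def)
    have G: "pdvd 2 (G - 1)"
      unfolding G_def a_eq using t p_gt_3 by (intro sin_prod_multiple) auto
    have "v * (u ^ 2 * H - c) = u * (u * v * H) - v * c"
      by (simp add: algebra_simps power2_eq_square)
    \<comment> \<open>Here -a (P + a) is exactly -c, which is the origin of the constant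
      \<open>c\<close>. The third factor p comes from u + v = P.\<close>
    also have "\<dots> = - (c * (u * (G - 1) + P))"
      unfolding shift by (simp add: c_def u_def v_def a_eq algebra_simps power2_eq_square)
    also have "pdvd (2 + 1) \<dots>"
      using G a c pdvd_mono [OF G, of 1]
      by (intro pdvd_minus pdvd_mult pdvd_add [of 1] pdvd_mult_left) (auto simp: u_def intro!: pdvd_intros)
    finally show ?thesis
      using punit_cancel [OF v, of 3] by simp
  next
    case False
    have IH: "pdvd 3 (a ^ 2 * G - c)"
      using Suc False by (simp add: a_def G_def)
    have "punit a"
      unfolding a_def using Suc.prems False t by (intro punit_add punit_of_nat_less)
        (auto intro: pdvd_P_mult simp del: One_nat_def simp: pdvd_mult_right)
    have "v * a * (u ^ 2 * H - c) = u * a * (u * v * H) - v * a * c"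
      by (simp add: algebra_simps power2_eq_square)
    \<comment> \<open>The new error is c times a multiple of p, because u (P + a) + v a = P (1 + 2
      a); as p^2 divides c, it vanishes modulo p^3.\<close>
    also have "\<dots> = - (u * (P + a) * (a ^ 2 * G - c)) - c * (P * (1 + 2 * a))"
      unfolding shift by (simp add: u_def v_def algebra_simps power2_eq_square)
    also have "pdvd 3 \<dots>"
    proof (intro pdvd_diff pdvd_minus)
      show "pdvd 3 (u * (P + a) * (a ^ 2 * G - c))"
        using IH a by (intro pdvd_mult_left) (auto simp: u_def intro!: pdvd_intros)
      have "pdvd (2 + 1) (c * (P * (1 + 2 * a)))"
        using c a by (intro pdvd_mult [of 2 c 1] pdvd_mult_right [of 1 P] pdvd_intros) auto
      then show "pdvd 3 (c * (P * (1 + 2 * a)))" by simp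
    qed
    finally show ?thesis
      using punit_cancel [OF punit_mult [OF v \<open>punit a\<close>], of 3] by simp
  qed
  then show ?case
    by (simp add: u_def H_def a_def add_ac)
qed simp

section \<open>Residue classes below p and their partial harmonic sums\<close>

text \<open>Indexing the class of -p j by j, not by its residue, makes (r + p j) / m an integer and
  reflection the map j -> m - 1 - j, whatever p is modulo m.\<close>

definition residues_by :: "nat \<Rightarrow> nat \<Rightarrow> nat set" where
  "residues_by m j = {r \<in> {1..p - 1}. m dvd r + p * j}"

definition partial_harm :: "nat \<Rightarrow> nat \<Rightarrow> nat \<Rightarrow> rat" where
  "partial_harm m j s = (\<Sum>r\<in>residues_by m j. 1 / of_nat r ^ s)"

lemma finite_residues_by [simp]: "finite (residues_by m j)"
  by (simp add: residues_by_def)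

lemma punit_residues_by: "r \<in> residues_by m j \<Longrightarrow> punit (of_nat r)"
  unfolding residues_by_def by (intro punit_of_nat_less) auto

lemma residues_by_1 [simp]: "residues_by (Suc 0) j = {1..p - 1}"
  by (auto simp: residues_by_def)

lemma pdvd_partial_harm [simp]: "pdvd 0 (partial_harm m j s)"
  unfolding partial_harm_def
  using punit_residues_by by (intro pdvd_sum pdvd_divide punit_power) auto

text \<open>The map r -> p - r exchanges the classes j and k, since (r + p j) + (p - r + p k) = p (j
  + k + 1).\<close>

lemma partial_harm_reflect_sum:
  assumes "m dvd j + k + 1"
  shows "partial_harm m k s = (\<Sum>r\<in>residues_by m j. 1 / (P - of_nat r) ^ s)"
  unfolding partial_harm_def
proof (rule sum.reindex_bij_witness [of _ "\<lambda>r. p - r" "\<lambda>r. p - r"])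
  have *: "p - r \<in> residues_by m k" if "r \<in> residues_by m j" "m dvd j + k + 1" for r j k
  proof -
    have r: "r \<in> {1..p - 1}" "m dvd r + p * j"
      using that by (auto simp: residues_by_def)
    have "(r + p * j) + (p - r + p * k) = p * (j + k + 1)"
      using r(1) by (auto simp: algebra_simps)
    then have "m dvd (r + p * j) + (p - r + p * k)"
      using that(2) by (simp only: dvd_mult)
    then have "m dvd p - r + p * k"
      using r(2) dvd_add_right_iff by blast
    then show ?thesis
      using r(1) by (auto simp: residues_by_def)
  qed
  show "p - r \<in> residues_by m k" if "r \<in> residues_by m j" for r
    using *[OF that assms] .
  show "p - r \<in> residues_by m j" if "r \<in> residues_by m k" for r
    using *[OF that, of j] assms by (simp add: add.commute)
qed (auto simp: residues_by_def of_nat_diff)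

lemma partial_harm_reflect:
  assumes "m dvd j + k + 1"
  shows "pdvd 3 (partial_harm m k 1 + partial_harm m j 1 + P * partial_harm m j 2 + P ^ 2 * partial_harm m j 3)"
    and "pdvd 2 (partial_harm m k 2 - partial_harm m j 2 - 2 * P * partial_harm m j 3)"
    and "pdvd 1 (partial_harm m k 3 + partial_harm m j 3)"
proof -
  have y: "punit (P - of_nat r)" if "r \<in> residues_by m j" for r
  proof -
    have "punit (of_nat (p - r))"
      using that by (intro punit_of_nat_less) (auto simp: residues_by_def)
    moreover have "r \<le> p"
      using that by (auto simp: residues_by_def)
    ultimately show ?thesis by (simp add: of_nat_diff)
  qed
  note x = punit_residues_by [of _ m j]
  have "partial_harm m k 1 + partial_harm m j 1 + P * partial_harm m j 2 + P ^ 2 * partial_harm m j 3 =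
      (\<Sum>r\<in>residues_by m j. P ^ 3 * (1 / (of_nat r ^ 3 * (P - of_nat r))))"
    unfolding partial_harm_reflect_sum [OF assms] unfolding partial_harm_def sum.distrib [symmetric] sum_distrib_left
  proof (rule sum.cong [OF refl])
    fix r assume "r \<in> residues_by m j"
    then have "of_nat r \<noteq> (0 :: rat)" "P - of_nat r \<noteq> 0"
      using x y by (blast dest: punit_nz)+
    then show "1 / (P - of_nat r) ^ 1 + 1 / of_nat r ^ 1 + P * (1 / of_nat r ^ 2) + P ^ 2 * (1 / of_nat r ^ 3)
        = P ^ 3 * (1 / (of_nat r ^ 3 * (P - of_nat r)))"
      by (rule inverse_reflect)
  qed
  also have "pdvd 3 \<dots>"
    using x y by (intro pdvd_sum pdvd_mult_right [of 3 "P ^ 3"] pdvd_divide punit_mult punit_power) auto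
  finally show "pdvd 3 (partial_harm m k 1 + partial_harm m j 1 + P * partial_harm m j 2 + P ^ 2 * partial_harm m j 3)" .
  have "partial_harm m k 2 - partial_harm m j 2 - 2 * P * partial_harm m j 3 =
      (\<Sum>r\<in>residues_by m j. P ^ 2 * ((3 * of_nat r - 2 * P) / (of_nat r ^ 3 * (P - of_nat r) ^ 2)))"
    unfolding partial_harm_reflect_sum [OF assms] unfolding partial_harm_def sum_subtractf [symmetric] sum_distrib_left
  proof (rule sum.cong [OF refl])
    fix r assume "r \<in> residues_by m j"
    then have "of_nat r \<noteq> (0 :: rat)" "P - of_nat r \<noteq> 0"
      using x y by (blast dest: punit_nz)+
    then show "1 / (P - of_nat r) ^ 2 - 1 / of_nat r ^ 2 - 2 * P * (1 / of_nat r ^ 3)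
        = P ^ 2 * ((3 * of_nat r - 2 * P) / (of_nat r ^ 3 * (P - of_nat r) ^ 2))"
      by (rule inverse_reflect)
  qed
  also have "pdvd 2 \<dots>"
    using x y by (intro pdvd_sum pdvd_mult_right [of 2 "P ^ 2"] pdvd_divide punit_mult punit_power pdvd_diff pdvd_mult_left) auto
  finally show "pdvd 2 (partial_harm m k 2 - partial_harm m j 2 - 2 * P * partial_harm m j 3)" .
  have "partial_harm m k 3 + partial_harm m j 3 = (\<Sum>r\<in>residues_by m j.
      P * ((of_nat r ^ 2 - of_nat r * (P - of_nat r) + (P - of_nat r) ^ 2) / (of_nat r ^ 3 * (P - of_nat r) ^ 3)))"
    unfolding partial_harm_reflect_sum [OF assms] unfolding partial_harm_def sum.distrib [symmetric]
  proof (rule sum.cong [OF refl])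
    fix r assume "r \<in> residues_by m j"
    then have "of_nat r \<noteq> (0 :: rat)" "P - of_nat r \<noteq> 0"
      using x y by (blast dest: punit_nz)+
    then show "1 / (P - of_nat r) ^ 3 + 1 / of_nat r ^ 3
        = P * ((of_nat r ^ 2 - of_nat r * (P - of_nat r) + (P - of_nat r) ^ 2) / (of_nat r ^ 3 * (P - of_nat r) ^ 3))"
      by (rule inverse_reflect)
  qed
  also have "pdvd 1 \<dots>"
    using x y 
        by (intro pdvd_sum pdvd_mult_right [of 1 P] pdvd_divide punit_mult punit_power pdvd_diff pdvd_add pdvd_mult_left pdvd_power0) auto
  finally show "pdvd 1 (partial_harm m k 3 + partial_harm m j 3)" .
qed

text \<open>The inverse map is division of m x by p with remainder, m x = p j + r: j < m because x <
  p, and r is nonzero because p divides neither m nor x.\<close>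

lemma residues_by_bij:
  assumes "m > 0" "\<not> p dvd m"
  shows "bij_betw (\<lambda>(j, r). (r + p * j) div m) (Sigma {..<m} (residues_by m)) {1..p - 1}"
proof (rule bij_betw_byWitness [where f' = "\<lambda>x. ((m * x) div p, (m * x) mod p)"])
  have p0: "p > 0" using p_gt_3 by simp
  have aux: "m * ((r + p * j) div m) = r + p * j \<and> (r + p * j) div m \<in> {1..p - 1} \<and> r < p"
    if "j < m" "r \<in> residues_by m j" for j r
  proof -
    have r: "1 \<le> r" "r \<le> p - 1" "m dvd r + p * j"
      using that by (auto simp: residues_by_def)
    define x where "x = (r + p * j) div m"
    have mx: "m * x = r + p * j"
      using r(3) by (simp add: x_def)
    have "p * j + p \<le> p * m"
      using that(1) mult_le_mono2 [of "Suc j" m p] by simp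
    then have "m * x < m * p"
      using r p0 unfolding mx by (simp add: mult.commute)
    then have "x < p" by simp
    moreover have "x \<noteq> 0" using mx r(1) by (intro notI) simp
    ultimately show ?thesis
      using mx r p0 by (auto simp: x_def)
  qed
  show "\<forall>a\<in>Sigma {..<m} (residues_by m). (m * (case a of (j, r) \<Rightarrow> (r + p * j) div m) div p,
      m * (case a of (j, r) \<Rightarrow> (r + p * j) div m) mod p) = a"
    using aux by auto
  show "(\<lambda>(j, r). (r + p * j) div m) ` Sigma {..<m} (residues_by m) \<subseteq> {1..p - 1}"
    using aux by fastforce
  show "\<forall>x\<in>{1..p - 1}. (case (m * x div p, m * x mod p) of (j, r) \<Rightarrow> (r + p * j) div m) = x"
    using assms(1) by (simp add: add.commute mult.commute)
  show "(\<lambda>x. (m * x div p, m * x mod p)) ` {1..p - 1} \<subseteq> Sigma {..<m} (residues_by m)"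
  proof clarify
    fix x assume x: "x \<in> {1..p - 1}"
    then have "\<not> p dvd x"
      using nat_dvd_not_less by auto
    then have "m * x mod p \<noteq> 0"
      using assms(2) prime_p by (simp add: mod_eq_0_iff_dvd prime_dvd_mult_iff)
    moreover have "m * x mod p < p"
      using p0 by simp
    moreover have "m * x div p < m"
    proof -
      have "x < p" using x p0 by auto
      then have "m * x < m * p" using assms(1) by simp
      then show ?thesis using p0 by (simp add: less_mult_imp_div_less)
    qed
    moreover have "m dvd m * x mod p + p * (m * x div p)"
      by (metis dvd_triv_left mod_mult_div_eq)
    ultimately show "m * x div p \<in> {..<m} \<and> m * x mod p \<in> residues_by m (m * x div p)"
      unfolding residues_by_def by auto
  qed
qed

lemma of_nat_residues_by:
  "m > 0 \<Longrightarrow> r \<in> residues_by m j \<Longrightarrow> (of_nat ((r + p * j) div m) :: rat) = (of_nat r + P * of_nat j) / of_nat m"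
  by (auto simp: residues_by_def elim!: dvdE)
    (metis mult.commute nonzero_mult_div_cancel_left of_nat_0_eq_iff of_nat_add of_nat_mult not_gr_zero)

lemma sum_residues_by:
  assumes "m > 0" "\<not> p dvd m"
  shows "(\<Sum>x\<in>{1..p - 1}. F (of_nat x :: rat)) =
    (\<Sum>j<m. \<Sum>r\<in>residues_by m j. F ((of_nat r + P * of_nat j) / of_nat m))"
  unfolding sum.reindex_bij_betw [OF residues_by_bij [OF assms], symmetric]
  by (subst sum.Sigma) (auto intro!: sum.cong simp: of_nat_residues_by [OF assms(1)])

lemma prod_residues_by:
  assumes "m > 0" "\<not> p dvd m"
  shows "(\<Prod>x\<in>{1..p - 1}. F (of_nat x :: rat)) =
    (\<Prod>j<m. \<Prod>r\<in>residues_by m j. F ((of_nat r + P * of_nat j) / of_nat m))"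
  unfolding prod.reindex_bij_betw [OF residues_by_bij [OF assms], symmetric]
  by (subst prod.Sigma) (auto intro!: prod.cong simp: of_nat_residues_by [OF assms(1)])

text \<open>If r + p j = d k, then r lies in the finer class i exactly when e divides k + p i, and
  this is solvable for i because p is invertible modulo e.\<close>

lemma residues_by_UN:
  assumes "d > 0" "e > 0" "\<not> p dvd e"
  shows "residues_by d j = (\<Union>i<e. residues_by (d * e) (j + d * i))"
proof (rule set_eqI, rule iffI)
  fix r assume r: "r \<in> residues_by d j"
  then obtain k where k: "r + p * j = d * k"
    by (auto simp: residues_by_def)
  have "coprime p e"
    using assms prime_p by (simp add: prime_imp_coprime)
  then obtain x where x: "[p * x = 1] (mod e)"
    using cong_solve_coprime_nat by auto
  \<comment> \<open>This is -k / p modulo e: x is the inverse of p, and e - 1 stands for -1 in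
    natural numbers.\<close>
  define i where "i = (x * (k * (e - 1))) mod e"
  have "[k + p * i = k + (p * x) * (k * (e - 1))] (mod e)"
    unfolding i_def by (intro cong_add cong_refl) (simp add: cong_def mod_simps mult.assoc)
  also have "[k + (p * x) * (k * (e - 1)) = k + 1 * (k * (e - 1))] (mod e)"
    using x by (intro cong_add cong_mult cong_refl)
  also have "k + 1 * (k * (e - 1)) = k * e"
    using assms(2) by (cases e) simp_all
  finally have "e dvd k + p * i"
    by (simp add: cong_def mod_eq_0_iff_dvd)
  then have "d * e dvd d * (k + p * i)"
    using assms(1) by simp
  also have "d * (k + p * i) = r + p * (j + d * i)"
    using k by (simp add: algebra_simps)
  finally have "r \<in> residues_by (d * e) (j + d * i)"
    using r by (simp add: residues_by_def)
  moreover have "i < e"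
    using assms(2) by (simp add: i_def)
  ultimately show "r \<in> (\<Union>i<e. residues_by (d * e) (j + d * i))"
    by blast
next
  fix r assume "r \<in> (\<Union>i<e. residues_by (d * e) (j + d * i))"
  then obtain i where i: "r \<in> {1..p - 1}" "d * e dvd r + p * (j + d * i)"
    by (auto simp: residues_by_def)
  have "d dvd r + p * (j + d * i)"
    using i(2) dvd_mult_left by blast
  also have "r + p * (j + d * i) = (r + p * j) + d * (p * i)"
    by (simp add: algebra_simps)
  finally have "d dvd r + p * j"
    by (metis dvd_add_left_iff dvd_triv_left)
  then show "r \<in> residues_by d j"
    using i(1) by (simp add: residues_by_def)
qed

lemma residues_by_disjoint:
  assumes "d > 0" "\<not> p dvd e" "i < e" "i' < e"
    and "r \<in> residues_by (d * e) (j + d * i)" "r \<in> residues_by (d * e) (j + d * i')"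
  shows "i = i'"
proof -
  have "coprime (int e) (int p)"
    using assms(2) prime_p by (metis coprime_commute coprime_int_iff prime_imp_coprime)
  have "int (d * e) dvd int (r + p * (j + d * i))" "int (d * e) dvd int (r + p * (j + d * i'))"
    using assms by (auto simp: residues_by_def simp del: of_nat_mult of_nat_add)
  then have "int (d * e) dvd int (r + p * (j + d * i)) - int (r + p * (j + d * i'))"
    by (rule dvd_diff)
  also have "\<dots> = int d * (int p * (int i - int i'))"
    by (simp add: algebra_simps)
  finally have "int e dvd int p * (int i - int i')"
    using assms(1) by simp
  then have "int e dvd int i - int i'"
    using \<open>coprime (int e) (int p)\<close> coprime_dvd_mult_right_iff by blast
  then have "[int i = int i'] (mod int e)"
    by (simp add: cong_iff_dvd_diff)
  then show ?thesis
    using assms(3,4) by (simp add: cong_def)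
qed

lemma partial_harm_refine:
  assumes "d > 0" "e > 0" "\<not> p dvd e"
  shows "partial_harm d j s = (\<Sum>i<e. partial_harm (d * e) (j + d * i) s)"
  unfolding partial_harm_def residues_by_UN [OF assms]
  by (rule sum.UNION_disjoint) (use residues_by_disjoint [OF assms(1,3)] in auto)

section \<open>Truncated logarithms and Fermat quotients\<close>

definition ln3 :: "rat \<Rightarrow> rat" where
  "ln3 x = x - x ^ 2 / 2 + x ^ 3 / 3"

text \<open>For \<open>x\<close> divisible by \<open>p\<close>, \<open>ln3 x\<close> is \<open>ln (1 + x)\<close> modulo \<open>p ^ 4\<close>, as \<open>p > 3\<close>.\<close>

lemma ln3_add:
  assumes "pdvd 1 x" "pdvd 1 y"
  shows "pdvd 4 (ln3 (x + y + x * y) - ln3 x - ln3 y)"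
proof -
  define u v where "u = x / P" and "v = y / P"
  have uv: "pdvd 0 u" "pdvd 0 v" "x = P * u" "y = P * v"
    using assms by (simp_all add: u_def v_def pdvd_def)
  have "ln3 (x + y + x * y) - ln3 x - ln3 y = P ^ 4 *
      (- (u ^ 2 * v ^ 2) / 2 + (u + v) ^ 2 * u * v + P * (u + v) * u ^ 2 * v ^ 2 + P ^ 2 * u ^ 3 * v ^ 3 / 3)"
    unfolding ln3_def uv(3,4) by (simp add: field_simps) algebra
  also have "pdvd 4 \<dots>"
    using uv(1,2) punit_2_3 by (intro pdvd_mult_right [of 4 "P ^ 4"] pdvd_divide pdvd_intros) auto
  finally show ?thesis .
qed

lemma ln3_prod:
  assumes "finite S" "\<And>i. i \<in> S \<Longrightarrow> pdvd 1 (x i)"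
  shows "pdvd 1 ((\<Prod>i\<in>S. 1 + x i) - 1) \<and> pdvd 4 (ln3 ((\<Prod>i\<in>S. 1 + x i) - 1) - (\<Sum>i\<in>S. ln3 (x i)))"
  using assms
proof (induction S rule: finite_induct)
  case empty
  then show ?case by (simp add: ln3_def)
next
  case (insert i S)
  define y where "y = (\<Prod>i\<in>S. 1 + x i) - 1"
  have y: "pdvd 1 y" "pdvd 4 (ln3 y - (\<Sum>i\<in>S. ln3 (x i)))" and xi: "pdvd 1 (x i)"
    using insert by (auto simp: y_def)
  have e: "(\<Prod>i\<in>insert i S. 1 + x i) - 1 = x i + y + x i * y"
    using insert.hyps by (simp add: y_def algebra_simps)
  have s: "ln3 (x i + y + x i * y) - (\<Sum>i\<in>insert i S. ln3 (x i)) =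
      (ln3 (x i + y + x i * y) - ln3 (x i) - ln3 y) + (ln3 y - (\<Sum>i\<in>S. ln3 (x i)))"
    using insert.hyps by simp
  show ?case
    unfolding e s using xi y pdvd_mono [of 1 "x i" 0]
    by (intro conjI pdvd_add ln3_add pdvd_mult_left) auto
qed

lemma residues_by_partition:
  assumes "m > 0" "\<not> p dvd m"
  shows "{1..p - 1} = (\<Union>j<m. residues_by m j)"
  using residues_by_UN [of 1 m 0] assms by simp

lemma sum_residues_by_partition:
  assumes "m > 0" "\<not> p dvd m"
  shows "sum F {1..p - 1} = (\<Sum>j<m. sum F (residues_by m j))"
  unfolding residues_by_partition [OF assms]
  by (rule sum.UNION_disjoint) (use residues_by_disjoint [of 1 m _ _ _ 0] assms in auto)

lemma prod_residues_by_partition: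
  assumes "m > 0" "\<not> p dvd m"
  shows "prod F {1..p - 1} = (\<Prod>j<m. prod F (residues_by m j))"
  unfolding residues_by_partition [OF assms]
  by (rule prod.UNION_disjoint) (use residues_by_disjoint [of 1 m _ _ _ 0] assms in auto)

text \<open>Both the product of all r and the product of all (r + p j) / m equal (p - 1)!. Their
  quotient is therefore 1, and clearing the p - 1 factors 1/m leaves the power of m.\<close>

lemma power_eq_prod_residues_by:
  assumes "m > 0" "\<not> p dvd m"
  shows "(of_nat m :: rat) ^ (p - 1) =
    (\<Prod>(j, r)\<in>Sigma {..<m} (residues_by m). 1 + P * of_nat j / of_nat r)"
proof -
  let ?T = "Sigma {..<m} (residues_by m)"
  define F :: rat where "F = (\<Prod>x\<in>{1..p - 1}. of_nat x)"
  have "F \<noteq> 0"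
    by (simp add: F_def)
  have 1: "F = (\<Prod>(j, r)\<in>?T. (of_nat r + P * of_nat j) / of_nat m)"
    unfolding F_def prod_residues_by [OF assms, of "\<lambda>x. x"] by (subst prod.Sigma) auto
  have 2: "F = (\<Prod>(j, r)\<in>?T. of_nat r)"
    unfolding F_def prod_residues_by_partition [OF assms] by (subst prod.Sigma) auto
  have card: "card ?T = p - 1"
    using bij_betw_same_card [OF residues_by_bij [OF assms]] by simp
  have "(\<Prod>(j, r)\<in>?T. 1 + P * of_nat j / of_nat r) =
      (\<Prod>(j, r)\<in>?T. of_nat m * ((of_nat r + P * of_nat j) / of_nat m) / of_nat r)"
  proof (rule prod.cong [OF refl], clarify)
    fix j r assume "r \<in> residues_by m j"
    then have "(of_nat r :: rat) \<noteq> 0"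
      by (blast dest: punit_residues_by punit_nz)
    then show "1 + P * of_nat j / of_nat r = of_nat m * ((of_nat r + P * of_nat j) / of_nat m) / of_nat r"
      using assms(1) by (simp add: field_simps)
  qed
  also have "\<dots> = (\<Prod>i\<in>?T. of_nat m) * (\<Prod>(j, r)\<in>?T. (of_nat r + P * of_nat j) / of_nat m) / (\<Prod>(j, r)\<in>?T. of_nat r)"
    by (simp only: case_prod_unfold prod.distrib prod_dividef)
  also have "\<dots> = of_nat m ^ (p - 1)"
    unfolding 1 [symmetric] 2 [symmetric] using \<open>F \<noteq> 0\<close> by (simp add: card)
  finally show ?thesis by (rule sym)
qed

text \<open>This stands for log(m^(p-1)) / p; in terms of the Fermat quotient q of m it is q - p q^2
  / 2 + p^2 q^3 / 3.\<close>

definition log_quotient :: "nat \<Rightarrow> rat" where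
  "log_quotient m = ln3 (of_nat m ^ (p - 1) - 1) / P"

text \<open>Every factor 1 + p j / r of the product for m^(p-1) is 1 modulo p, which already gives
  Fermat's theorem. The logarithm turns the product into sums of (p j / r)^s / s for s = 1, 2, 3,
  and dividing by p lowers the precision from p^4 to p^3.\<close>

lemma
  assumes "m > 0" "\<not> p dvd m"
  shows fermat_little: "pdvd 1 (of_nat m ^ (p - 1) - 1)"
    and log_quotient_eq: "pdvd 3 (log_quotient m - (\<Sum>j<m. of_nat j * partial_harm m j 1
      - of_nat j ^ 2 / 2 * (P * partial_harm m j 2) + of_nat j ^ 3 / 3 * (P ^ 2 * partial_harm m j 3)))"
proof -
  let ?T = "Sigma {..<m} (residues_by m)"
  define x where "x = (\<lambda>(j, r). P * (of_nat j / of_nat r))"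
  have "pdvd 1 (x i)" if "i \<in> ?T" for i
    using that punit_residues_by by (auto simp: x_def simp del: One_nat_def intro!: pdvd_mult_right [of 1 P] pdvd_divide)
  moreover have "finite ?T" by auto
  ultimately have *: "pdvd 1 ((\<Prod>i\<in>?T. 1 + x i) - 1) \<and> pdvd 4 (ln3 ((\<Prod>i\<in>?T. 1 + x i) - 1)
        - (\<Sum>i\<in>?T. ln3 (x i)))"
    by (intro ln3_prod)
  have e: "(\<Prod>i\<in>?T. 1 + x i) = of_nat m ^ (p - 1)"
    unfolding power_eq_prod_residues_by [OF assms] by (simp add: x_def case_prod_beta)
  show "pdvd 1 (of_nat m ^ (p - 1) - 1)"
    using * unfolding e by blast
  have "(\<Sum>i\<in>?T. ln3 (x i)) = (\<Sum>j<m. \<Sum>r\<in>residues_by m j. ln3 (P * (of_nat j / of_nat r)))"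
    by (subst sum.Sigma) (auto simp: x_def case_prod_beta)
  also have "\<dots> = P * (\<Sum>j<m. of_nat j * partial_harm m j 1
      - of_nat j ^ 2 / 2 * (P * partial_harm m j 2) + of_nat j ^ 3 / 3 * (P ^ 2 * partial_harm m j 3))"
    unfolding sum_distrib_left
  proof (rule sum.cong [OF refl])
    fix j
    have "ln3 (P * (of_nat j / of_nat r)) = P * of_nat j * (1 / of_nat r ^ 1)
      - P ^ 2 * of_nat j ^ 2 / 2 * (1 / of_nat r ^ 2) + P ^ 3 * of_nat j ^ 3 / 3 * (1 / of_nat r ^ 3)" for r
      by (simp add: ln3_def power_mult_distrib power_divide)
    then show "(\<Sum>r\<in>residues_by m j. ln3 (P * (of_nat j / of_nat r))) = P * (of_nat j * partial_harm m j 1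
      - of_nat j ^ 2 / 2 * (P * partial_harm m j 2) + of_nat j ^ 3 / 3 * (P ^ 2 * partial_harm m j 3))"
      unfolding partial_harm_def
      by (simp only: sum.distrib sum_subtractf sum_distrib_left [symmetric])
        (simp add: algebra_simps power2_eq_square power3_eq_cube)
  qed
  finally have s: "(\<Sum>i\<in>?T. ln3 (x i)) = P * (\<Sum>j<m. of_nat j * partial_harm m j 1
      - of_nat j ^ 2 / 2 * (P * partial_harm m j 2) + of_nat j ^ 3 / 3 * (P ^ 2 * partial_harm m j 3))" .
  have l: "ln3 (of_nat m ^ (p - 1) - 1) = P * log_quotient m"
    by (simp add: log_quotient_def)
  show "pdvd 3 (log_quotient m - (\<Sum>j<m. of_nat j * partial_harm m j 1
      - of_nat j ^ 2 / 2 * (P * partial_harm m j 2) + of_nat j ^ 3 / 3 * (P ^ 2 * partial_harm m j 3)))"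
    using * pdvd_P_power_mult [of 1 3] unfolding e s l right_diff_distrib [symmetric] by simp
qed

lemma log_quotient_mult:
  assumes "m > 0" "\<not> p dvd m" "n > 0" "\<not> p dvd n"
  shows "pdvd 3 (log_quotient (m * n) - log_quotient m - log_quotient n)"
proof -
  have "pdvd 4 (P * (log_quotient (m * n) - log_quotient m - log_quotient n))"
    using ln3_add [OF fermat_little [OF assms(1,2)] fermat_little [OF assms(3,4)]]
    by (simp add: log_quotient_def power_mult_distrib algebra_simps)
  then show ?thesis
    using pdvd_P_power_mult [of 1 3] by simp
qed

text \<open>With x = (r + p j) / m, H / m^2 becomes the sum of 1 / (r + p j)^2, and modulo p^2 each
  summand is 1 / r^2 - 2 p j / r^3.\<close>

lemma harm_2_relation:
  assumes "m > 0" "\<not> p dvd m"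
  shows "pdvd 2 ((1 / of_nat m ^ 2 - 1) * partial_harm 1 0 2 + 2 * (\<Sum>j<m. of_nat j * (P * partial_harm m j 3)))"
proof -
  have "1 / of_nat m ^ 2 * partial_harm 1 0 2 = (\<Sum>j<m. \<Sum>r\<in>residues_by m j. 1 / (of_nat r + P * of_nat j) ^ 2)"
    using assms(1) sum_residues_by [OF assms, of "\<lambda>x. 1 / of_nat m ^ 2 * (1 / x ^ 2)"]
    by (simp add: partial_harm_def sum_distrib_left power_divide)
  moreover have "partial_harm 1 0 2 = (\<Sum>j<m. \<Sum>r\<in>residues_by m j. 1 / of_nat r ^ 2)"
    using sum_residues_by_partition [OF assms] by (simp add: partial_harm_def)
  ultimately have "(1 / of_nat m ^ 2 - 1) * partial_harm 1 0 2 + 2 * (\<Sum>j<m. of_nat j * (P * partial_harm m j 3))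
    = (\<Sum>j<m. \<Sum>r\<in>residues_by m j. 1 / (of_nat r + P * of_nat j) ^ 2)
        - (\<Sum>j<m. \<Sum>r\<in>residues_by m j. 1 / of_nat r ^ 2)
      + 2 * (\<Sum>j<m. of_nat j * (P * partial_harm m j 3))"
    by (simp only: left_diff_distrib mult_1)
  also have "\<dots> = (\<Sum>j<m. \<Sum>r\<in>residues_by m j. 1 / (of_nat r + P * of_nat j) ^ 2
        - 1 / of_nat r ^ 2 + 2 * of_nat j * P * (1 / of_nat r ^ 3))"
    by (simp add: mult_ac partial_harm_def sum.distrib sum_subtractf sum_distrib_left)
  also have "pdvd 2 \<dots>"
  proof (intro pdvd_sum)
    fix j r assume "r \<in> residues_by m j"
    then have r: "punit (of_nat r)" by (rule punit_residues_by)
    define x y where "x = (of_nat r :: rat)" and "y = P * of_nat j"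
    have y1: "pdvd 1 y"
      unfolding y_def by (intro pdvd_mult_right [of 1]) auto
    have y: "punit (x + y)"
      unfolding x_def using r y1 by (rule punit_add)
    have "x \<noteq> 0" "x + y \<noteq> 0"
      using y r unfolding x_def by (blast dest: punit_nz)+
    then have "1 / (x + y) ^ 2 - 1 / x ^ 2 + 2 * y * (1 / x ^ 3) = y ^ 2 * ((3 * x + 2 * y) / (x ^ 3 * (x + y) ^ 2))"
      by (simp add: divide_simps) algebra
    also have "pdvd 2 \<dots>"
      using y r pdvd_power [of 1 y 2] pdvd_mono [of 1 y 0] y1
      by (intro pdvd_mult_right [of 2 "y ^ 2"] pdvd_divide punit_mult punit_power pdvd_add pdvd_mult_left)
        (auto simp: x_def)
    finally show "pdvd 2 (1 / (of_nat r + P * of_nat j) ^ 2 - 1 / of_nat r ^ 2 + 2 * of_nat j * P * (1 / of_nat r ^ 3))"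
      by (simp add: x_def y_def mult_ac)
  qed
  finally show ?thesis .
qed

section \<open>The hypergeometric sum in terms of partial harmonic sums\<close>

text \<open>For m = 1 the only class is its own reflection, so twice the sum vanishes modulo
  p.\<close>

lemma pdvd_harm_3: "pdvd 1 (partial_harm 1 0 3)"
  using partial_harm_reflect(3) [of 1 0 0] punit_cancel [OF punit_2_3(1), of 1 "partial_harm 1 0 3"]
  by simp

text \<open>Each coefficient is -p t (k + p t) / k^2 times a sine product that is 1 modulo p^2. What
  remains besides -p t H is -p^2 t^2 times the sum of 1 / k^3, and p divides that sum.\<close>

lemma hyp_sum_multiple:
  assumes t: "pdvd 0 t"
  shows "pdvd 3 (hyp_sum (p - 1) (P * t) + P * t * partial_harm 1 0 2)"
proof -
  define G where "G k = sin_prod (P * t) (k - 1)" for k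
  have "hyp_sum (p - 1) (P * t) + P * t * partial_harm 1 0 2 =
      (\<Sum>k\<in>{1..p - 1}. hyp_coeff (P * t) k / of_nat k + P * t * (1 / of_nat k ^ 2))"
    by (simp add: hyp_sum_def partial_harm_def sum.distrib sum_distrib_left)
  also have "\<dots> = (\<Sum>k\<in>{1..p - 1}. - (P * (t * (of_nat k + P * t) / of_nat k ^ 3) * (G k - 1))
      - P ^ 2 * t ^ 2 * (1 / of_nat k ^ 3))"
  proof (rule sum.cong [OF refl])
    fix k assume "k \<in> {1..p - 1}"
    then obtain l where l: "k = Suc l"
      by (cases k) auto
    define x :: rat where "x = of_nat k"
    have "x \<noteq> 0" by (simp add: x_def l)
    then show "hyp_coeff (P * t) k / of_nat k + P * t * (1 / of_nat k ^ 2) =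
      - (P * (t * (of_nat k + P * t) / of_nat k ^ 3) * (G k - 1)) - P ^ 2 * t ^ 2 * (1 / of_nat k ^ 3)"
      unfolding l hyp_coeff_eq_sin_prod G_def diff_Suc_1 unfolding l [symmetric] x_def [symmetric]
      by (simp add: field_simps power2_eq_square power3_eq_cube)
  qed
  also have "\<dots> = (\<Sum>k\<in>{1..p - 1}. - (P * (t * (of_nat k + P * t) / of_nat k ^ 3) * (G k - 1)))
      - P ^ 2 * t ^ 2 * partial_harm 1 0 3"
    by (simp add: sum_subtractf sum_distrib_left partial_harm_def)
  also have "pdvd 3 \<dots>"
  proof (intro pdvd_diff pdvd_sum pdvd_minus)
    fix k assume k: "k \<in> {1..p - 1}"
    have "pdvd 2 (G k - 1)"
      unfolding G_def using k p_gt_3 by (intro sin_prod_multiple t) auto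
    moreover have "pdvd 1 (P * (t * (of_nat k + P * t) / of_nat k ^ 3))"
      using k t by (intro pdvd_mult_right [of 1 P] pdvd_divide pdvd_mult_left pdvd_add punit_power punit_of_nat_less) auto
    ultimately have "pdvd (1 + 2) (P * (t * (of_nat k + P * t) / of_nat k ^ 3) * (G k - 1))"
      by (rule pdvd_mult [rotated])
    then show "pdvd 3 (P * (t * (of_nat k + P * t) / of_nat k ^ 3) * (G k - 1))"
      by (simp add: numeral_3_eq_3)
  next
    have "pdvd (2 + 1) (P ^ 2 * t ^ 2 * partial_harm 1 0 3)"
      using t by (intro pdvd_mult pdvd_harm_3 pdvd_mult_right [of 2 "P ^ 2"] pdvd_power0) auto
    then show "pdvd 3 (P ^ 2 * t ^ 2 * partial_harm 1 0 3)"
      by simp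
  qed
  finally show ?thesis .
qed

lemma hyp_sum_telescope:
  assumes "\<And>i. i \<in> {1..N} \<Longrightarrow> b + of_nat i \<noteq> 0"
  shows "hyp_sum n (b + of_nat N) = hyp_sum n b + (\<Sum>i\<in>{1..N}. 2 / (b + of_nat i) * (sin_prod (b + of_nat i) n - 1))"
  using assms
proof (induction N)
  case (Suc N)
  have "hyp_sum n (b + of_nat (Suc N)) - hyp_sum n (b + of_nat N)
      = 2 / (b + of_nat (Suc N)) * (sin_prod (b + of_nat (Suc N)) n - 1)"
    using hyp_sum_diff [of "b + of_nat (Suc N)" n] Suc.prems [of "Suc N"] by (simp add: add_ac)
  moreover have "hyp_sum n (b + of_nat N) = hyp_sum n b + (\<Sum>i\<in>{1..N}. 2 / (b + of_nat i) * (sin_prod (b + of_nat i) n - 1))"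
    by (intro Suc.IH Suc.prems) auto
  ultimately show ?case
    by (simp del: of_nat_Suc)
qed simp

text \<open>With t = -1/m the i-th step lands on p t + i = -r / m for r = p - m i. These r run
  through the class j = m - 1, because -p (m - 1) is p modulo m, and they never reach 0 because m
  does not divide p.\<close>

lemma hyp_sum_cong:
  assumes m: "m > 0" "\<not> p dvd m" "\<not> m dvd p"
  shows "pdvd 3 (hyp_sum (p - 1) (- of_nat (p mod m) / of_nat m) -
    (2 * of_nat m * partial_harm m (m - 1) 1 + 2 * of_nat m * (of_nat m - 1) * (P ^ 2 * partial_harm m (m - 1) 3)
      + P * partial_harm 1 0 2 / of_nat m))"
proof -
  define t where "t = - 1 / (of_nat m :: rat)"
  define N where "N = p div m"
  define M :: rat where "M = of_nat m"
  have M: "M \<noteq> 0" "t = - 1 / M" "punit M" "m > 1"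
    using m punit_of_nat by (auto simp: M_def t_def) (metis One_nat_def Suc_lessI one_dvd)
  have t: "pdvd 0 t"
    unfolding M(2) using M(3) by (intro pdvd_divide pdvd_minus) auto
  have i_less: "i < p" "m * i < p" if "i \<in> {1..N}" for i
  proof -
    have "m * i \<le> m * (p div m)"
      using that by (simp add: N_def)
    also have "\<dots> \<le> p" by simp
    finally have "m * i \<le> p" .
    moreover have "m * i \<noteq> p" using m(3) by auto
    ultimately show "m * i < p" by simp
    have "1 * i \<le> m * i" using m(1) by (intro mult_le_mono1) simp
    then show "i < p" using \<open>m * i < p\<close> by linarith
  qed
  define r where "r i = p - m * i" for i
  have r: "P * t + of_nat i = - of_nat (r i) / M" "of_nat (r i) \<noteq> (0 :: rat)" if "i \<in> {1..N}" for i
  proof -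
    have P: "P = of_nat (r i) + M * of_nat i"
      using i_less [OF that] by (simp add: r_def of_nat_diff M_def)
    show "P * t + of_nat i = - of_nat (r i) / M"
      using M(1) unfolding P M(2) by (simp add: field_simps)
    show "of_nat (r i) \<noteq> (0 :: rat)"
      using i_less [OF that] unfolding r_def of_nat_eq_0_iff by simp
  qed
  \<comment> \<open>Obtained from 2 / a times (p^2 t (t + 1) / a^2 - 1) by inserting t = -1/m and a
    = -x/m.\<close>
  define f where "f x = 2 * M * (1 / of_nat x ^ 1) + 2 * M * (M - 1) * P ^ 2 * (1 / of_nat x ^ 3)" for x
  have summand: "pdvd 3 (2 / (P * t + of_nat i) * (sin_prod (P * t + of_nat i) (p - 1) - 1) - f (r i))"
    if i: "i \<in> {1..N}" for i
  proof -
    define a where "a = of_nat i + P * t"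
    have a: "punit a"
      unfolding a_def using i_less [OF i] i t
      by (intro punit_add punit_of_nat_less pdvd_mult_right [of 1]) auto
    define x :: rat where "x = of_nat (r i)"
    define G where "G = sin_prod a (p - 1)"
    have ax: "a = - x / M" "x \<noteq> 0"
      using r [OF i] by (simp_all add: a_def x_def add.commute)
    have "2 / a * (G - 1) - (2 * M * (1 / x ^ 1) + 2 * M * (M - 1) * P ^ 2 * (1 / x ^ 3))
        = 2 / a ^ 3 * (a ^ 2 * G - P ^ 2 * (t * (t + 1)))"
      unfolding ax(1) M(2) using ax(2) M(1) by (simp add: field_simps power2_eq_square power3_eq_cube)
    also have "pdvd 3 \<dots>"
      using a sin_prod_shifted_multiple [OF t, of i] i i_less [OF i]
      by (intro pdvd_mult_left pdvd_divide punit_power) (auto simp: a_def G_def)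
    finally show ?thesis
      by (simp add: f_def a_def G_def x_def add.commute)
  qed
  have "(\<Sum>i\<in>{1..N}. f (r i)) = sum f (residues_by m (m - 1))"
  proof (rule sum.reindex_bij_witness [of _ "\<lambda>x. (p - x) div m" r])
    fix i assume i: "i \<in> {1..N}"
    show "(p - r i) div m = i"
      using i_less [OF i] m(1) by (simp add: r_def)
    have "r i + p * (m - 1) + m * i = p * m"
      using i_less [OF i] m(1) by (cases m) (auto simp: r_def algebra_simps)
    then have "m dvd r i + p * (m - 1) + m * i"
      by simp
    then have "m dvd r i + p * (m - 1)"
      by (metis dvd_add_left_iff dvd_triv_left)
    moreover have "1 \<le> m * i" using i m(1) by simp
    then have "1 \<le> r i" "r i \<le> p - 1"
      using i_less(2) [OF i] unfolding r_def by linarith+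
    ultimately show "r i \<in> residues_by m (m - 1)"
      by (simp add: residues_by_def)
  next
    fix x assume "x \<in> residues_by m (m - 1)"
    then have x: "1 \<le> x" "x < p" "m dvd x + p * (m - 1)"
      using p_gt_3 by (auto simp: residues_by_def)
    have "(p - x) + (x + p * (m - 1)) = p * m"
      using x(2) m(1) by (cases m) auto
    then have "m dvd (p - x) + (x + p * (m - 1))"
      by simp
    then have "m dvd p - x"
      using x(3) dvd_add_left_iff by blast
    then obtain i where i: "p - x = m * i" ..
    then have "i > 0" using x(2) by (intro gr0I) simp
    have "(p - x) div m = i" using i m(1) by simp
    moreover have "i \<le> N"
      unfolding N_def using div_le_mono [of "p - x" p m] \<open>(p - x) div m = i\<close> by simp
    ultimately show "(p - x) div m \<in> {1..N}"
      using \<open>i > 0\<close> by simp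
    show "r ((p - x) div m) = x"
      unfolding \<open>(p - x) div m = i\<close> using i x(2) by (simp add: r_def flip: i)
  qed auto
  also have "\<dots> = 2 * M * partial_harm m (m - 1) 1 + 2 * M * (M - 1) * (P ^ 2 * partial_harm m (m - 1) 3)"
    unfolding partial_harm_def sum_distrib_left sum.distrib [symmetric]
    by (rule sum.cong) (simp_all add: f_def mult.assoc)
  finally have sum_f: "(\<Sum>i\<in>{1..N}. f (r i)) =
      2 * M * partial_harm m (m - 1) 1 + 2 * M * (M - 1) * (P ^ 2 * partial_harm m (m - 1) 3)" .
  have "P = of_nat (m * N + p mod m)"
    by (simp add: N_def)
  then have "- of_nat (p mod m) / of_nat m = P * t + of_nat N"
    using M(1) unfolding M(2) M_def by (simp add: field_simps)
  moreover have "P * t + of_nat i \<noteq> 0" if "i \<in> {1..N}" for i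
    using r [OF that] M(1) by simp
  ultimately have e: "hyp_sum (p - 1) (- of_nat (p mod m) / of_nat m) = hyp_sum (p - 1) (P * t) +
      (\<Sum>i\<in>{1..N}. 2 / (P * t + of_nat i) * (sin_prod (P * t + of_nat i) (p - 1) - 1))"
    using hyp_sum_telescope [of N "P * t" "p - 1"] by simp
  have "hyp_sum (p - 1) (- of_nat (p mod m) / of_nat m) -
      (2 * M * partial_harm m (m - 1) 1 + 2 * M * (M - 1) * (P ^ 2 * partial_harm m (m - 1) 3)
      + P * partial_harm 1 0 2 / M) =
    (\<Sum>i\<in>{1..N}. 2 / (P * t + of_nat i) * (sin_prod (P * t + of_nat i) (p - 1) - 1) - f (r i))
      + (hyp_sum (p - 1) (P * t) + P * t * partial_harm 1 0 2)"
    unfolding e sum_f [symmetric] sum_subtractf M(2) by simp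
  also have "pdvd 3 \<dots>"
    by (intro pdvd_add pdvd_sum summand hyp_sum_multiple t)
  finally show ?thesis
    unfolding M_def .
qed

section \<open>Bernoulli numbers and power sums modulo p^2\<close>

text \<open>The recurrence for index k divides by k + 1, which stays below p until k = p -
  1.\<close>

lemma pdvd_bernoulli: "k < p - 1 \<Longrightarrow> pdvd 0 (bernoulli k)"
proof (induction k rule: less_induct)
  case (less k)
  show ?case
  proof (cases k)
    case (Suc n)
    have "punit (of_nat (n + 2))"
      using less.prems Suc by (intro punit_of_nat_less) auto
    then show ?thesis
      unfolding Suc bernoulli.simps using less Suc
      by (intro pdvd_divide pdvd_minus pdvd_sum pdvd_mult_left) auto
  qed simp
qed

text \<open>In Faulhaber's formula for N = p - 2 at the argument p, only the summand k = p - 3 has p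
  to the first power; the others carry p^2 and p-integral Bernoulli numbers, and N is a
  unit.\<close>

lemma power_sum_bernoulli:
  "pdvd 2 ((\<Sum>x\<in>{1..p - 1}. of_nat x ^ (p - 3)) - P * bernoulli (p - 3))"
proof -
  define n where "n = p - 3"
  have n: "p - 2 = Suc n" "n > 0" "p = n + 3"
    using p_gt_3 by (auto simp: n_def)
  have u: "punit (of_nat (Suc n))"
    by (intro punit_of_nat_less) (auto simp: n(3))
  have "(\<Sum>x<p. of_nat x ^ n :: rat) = (\<Sum>x\<in>{1..p - 1}. of_nat x ^ n)"
    \<comment> \<open>The summand x = 0 is dropped; it is 0 because the exponent n is
      positive.\<close>
    using n by (intro sum.mono_neutral_right) auto
  then have "of_nat (Suc n) * (\<Sum>x\<in>{1..p - 1}. of_nat x ^ n) = bernoulli_sum (Suc n) P"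
    using faulhaber [of "Suc n" p] by simp
  also have "\<dots> = (\<Sum>k<n. of_nat (Suc n choose k) * bernoulli k * P ^ (Suc n - k)) + of_nat (Suc n) * bernoulli n * P"
    by (simp add: bernoulli_sum_def)
  finally have "of_nat (Suc n) * ((\<Sum>x\<in>{1..p - 1}. of_nat x ^ n) - P * bernoulli n)
      = (\<Sum>k<n. of_nat (Suc n choose k) * bernoulli k * P ^ (Suc n - k))"
    by (simp only: right_diff_distrib mult_ac)
  also have "pdvd 2 \<dots>"
  proof (intro pdvd_sum pdvd_mult_left)
    fix k assume "k \<in> {..<n}"
    then show "pdvd 0 (bernoulli k)" "pdvd 2 (P ^ (Suc n - k))"
      using pdvd_mono [OF pdvd_P_power, of 2 "Suc n - k"] pdvd_bernoulli [of k] by (auto simp: n(3))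
  qed simp
  finally show ?thesis
    unfolding n_def [symmetric] by (rule punit_cancel [OF u])
qed

lemma pdvd_power_add:
  assumes "pdvd 0 x" "pdvd 1 y"
  shows "pdvd 2 ((x + y) ^ Suc n - x ^ Suc n - of_nat (Suc n) * x ^ n * y)"
proof (induction n)
  case (Suc n)
  have "(x + y) ^ Suc (Suc n) - x ^ Suc (Suc n) - of_nat (Suc (Suc n)) * x ^ Suc n * y =
      (x + y) * ((x + y) ^ Suc n - x ^ Suc n - of_nat (Suc n) * x ^ n * y) + of_nat (Suc n) * x ^ n * y ^ 2"
    by (simp add: algebra_simps power2_eq_square)
  also have "pdvd 2 \<dots>"
    using assms pdvd_mono [OF assms(2), of 0] pdvd_power [OF assms(2), of 2]
    by (intro pdvd_add pdvd_mult_left Suc.IH pdvd_power0 pdvd_of_nat) auto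
  finally show ?case .
qed simp

text \<open>The substitution \<open>x = (r + P * j) / 2\<close> compares the power sums of exponents \<open>- 2\<close> and \<open>p - 3\<close>
  (equal modulo \<open>p - 1\<close>) with the same partial sum of \<open>1 / r\<^sup>3\<close>; the ratio of the results,
  \<open>2 / 3\<close>, is the ratio of the exponents modulo \<open>p\<close>.\<close>

lemma harm_2_bernoulli: "pdvd 2 (partial_harm 1 0 2 - 2 / 3 * P * bernoulli (p - 3))"
proof -
  define n where "n = p - 4"
  have n: "p - 3 = Suc n" "p = n + 4"
    using p_gt_3 by (auto simp: n_def)
  have m: "(2 :: nat) > 0" "\<not> p dvd 2"
    using p_gt_3 by (auto dest: dvd_imp_le)
  have lt_2: "{..<2 :: nat} = {0, 1}"
    by auto
  define S :: rat where "S = (\<Sum>x\<in>{1..p - 1}. of_nat x ^ Suc n)"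
  define H where "H = partial_harm 1 0 2"
  define K where "K = P * partial_harm 2 1 3"
  define X :: rat where "X = 2 ^ (p - 1) - 1"
  have K: "pdvd 1 K"
    unfolding K_def by (intro pdvd_mult_right [of 1]) auto
  have X: "pdvd 1 X"
    using fermat_little [OF m] by (simp add: X_def)
  have HK: "pdvd 2 (- 3 / 4 * H + 2 * K)"
    using harm_2_relation [OF m] by (simp add: H_def K_def lt_2)
  have S0: "pdvd 0 S"
    unfolding S_def by (intro pdvd_sum pdvd_power0) auto
  have "S = (\<Sum>j<2. \<Sum>r\<in>residues_by 2 j. ((of_nat r + P * of_nat j) / 2) ^ Suc n)"
    unfolding S_def using sum_residues_by [OF m, of "\<lambda>x. x ^ Suc n"] by (simp only: of_nat_numeral)
  also have "\<dots> = (\<Sum>j<2. \<Sum>r\<in>residues_by 2 j. (of_nat r + P * of_nat j) ^ Suc n) / 2 ^ Suc n"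
    by (simp only: power_divide sum_divide_distrib)
  finally have "2 ^ Suc n * S = (\<Sum>j<2. \<Sum>r\<in>residues_by 2 j. (of_nat r + P * of_nat j) ^ Suc n)"
    by simp
  moreover have "S = (\<Sum>j<2. \<Sum>r\<in>residues_by 2 j. of_nat r ^ Suc n)"
    unfolding S_def by (rule sum_residues_by_partition [OF m])
  ultimately have "2 ^ Suc n * S - S = (\<Sum>r\<in>residues_by 2 1. (of_nat r + P) ^ Suc n - of_nat r ^ Suc n)"
    by (simp only: sum_subtractf) (simp add: lt_2)
  then have "2 ^ Suc n * S - S + 3 * K = (\<Sum>r\<in>residues_by 2 1.
      ((of_nat r + P) ^ Suc n - of_nat r ^ Suc n - of_nat (Suc n) * of_nat r ^ n * P)
      + P * (of_nat (Suc n) * of_nat r ^ n + 3 * (1 / of_nat r ^ 3)))"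
    by (simp add: K_def partial_harm_def sum.distrib sum_subtractf sum_distrib_left algebra_simps)
  also have "pdvd 2 \<dots>"
  proof (intro pdvd_sum pdvd_add)
    fix r assume r: "r \<in> residues_by 2 1"
    show "pdvd 2 ((of_nat r + P) ^ Suc n - of_nat r ^ Suc n - of_nat (Suc n) * of_nat r ^ n * P)"
      by (rule pdvd_power_add) auto
    have u: "punit (of_nat r)" by (rule punit_residues_by [OF r])
    have r': "r > 0" "\<not> p dvd r"
      using r by (auto simp: residues_by_def dest!: dvd_imp_le)
    \<comment> \<open>Since \<open>Suc n\<close> is p - 3 and r^n = r^(p-1) / r^3, Fermat's theorem
      makes this divisible by p.\<close>
    have "of_nat (Suc n) * of_nat r ^ n + 3 * (1 / of_nat r ^ 3) =
        P * of_nat r ^ n - 3 * ((of_nat r ^ (p - 1) - 1) / of_nat r ^ 3)"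
    proof -
      have "(of_nat r ^ (p - 1) :: rat) = of_nat r ^ n * of_nat r ^ 3"
        by (simp add: n(2) add.commute flip: power_add)
      moreover have "P = of_nat (Suc n) + 3"
        by (simp add: n(2))
      ultimately show ?thesis
        using punit_nz [OF u] by (simp add: field_simps)
    qed
    also have "pdvd 1 \<dots>"
    proof (rule pdvd_diff)
      show "pdvd 1 (P * of_nat r ^ n)"
        by (intro pdvd_mult_right [of 1] pdvd_power0) auto
      show "pdvd 1 (3 * ((of_nat r ^ (p - 1) - 1) / of_nat r ^ 3))"
        by (intro pdvd_mult_left pdvd_divide punit_power u fermat_little r') auto
    qed
    finally show "pdvd 2 (P * (of_nat (Suc n) * of_nat r ^ n + 3 * (1 / of_nat r ^ 3)))"
      using pdvd_P_mult [of 1] by (simp only: numeral_2_eq_2 One_nat_def)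
  qed
  finally have SK: "pdvd 2 (2 ^ Suc n * S - S + 3 * K)" .
  have two: "2 ^ Suc n = (1 + X) / 4"
    by (simp add: X_def n(2) power_add)
  \<comment> \<open>Modulo p both X and K vanish, so the relation reduces to -3/4 S = 0. Hence p
    divides S, and X S can be discarded modulo p^2.\<close>
  have "3 * S = (X * S + 4 * (3 * K)) - 4 * (2 ^ Suc n * S - S + 3 * K)"
    unfolding two by (simp add: algebra_simps)
  also have "pdvd 1 \<dots>"
    by (intro pdvd_diff pdvd_add pdvd_mult_right [OF X S0] pdvd_mult_left [OF pdvd_numeral(1)] K
      pdvd_mono [OF SK, of 1]) auto
  finally have "pdvd 1 S"
    by (rule punit_cancel [OF punit_2_3(2)])
  then have XS: "pdvd 2 (X * S)"
    using pdvd_mult [OF X, of 1 S] by (simp only: one_add_one)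
  have SB: "pdvd 2 (S - P * bernoulli (p - 3))"
    using power_sum_bernoulli unfolding S_def n(1) .
  \<comment> \<open>The weights -12 and 8 eliminate K between the relations for H and S.\<close>
  have "3 ^ 2 * (H - 2 / 3 * P * bernoulli (p - 3)) =
      - (12 * (- 3 / 4 * H + 2 * K)) + 8 * (2 ^ Suc n * S - S + 3 * K) - 2 * (X * S) + 6 * (S - P * bernoulli (p - 3))"
    unfolding two by (simp add: algebra_simps)
  also have "pdvd 2 \<dots>"
    by (intro pdvd_diff pdvd_add pdvd_minus pdvd_mult_left [OF pdvd_numeral(1)] HK SK XS SB)
  finally show ?thesis
    unfolding H_def by (rule punit_cancel [OF punit_power [OF punit_2_3(2)]])
qed

section \<open>The relations on a common scale\<close>

text \<open>The scaling makes every relation below a congruence modulo \<open>p ^ 3\<close>.\<close>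

definition scaled_harm :: "nat \<Rightarrow> nat \<Rightarrow> nat \<Rightarrow> rat" where
  "scaled_harm m j s = P ^ (s - 1) * partial_harm m j s"

lemma pdvd_3_mult: "pdvd 2 x \<Longrightarrow> pdvd 3 (P * x)" "pdvd 1 x \<Longrightarrow> pdvd 3 (P ^ 2 * x)"
  using pdvd_mult [of 1 P 2 x] pdvd_mult [of 2 "P ^ 2" 1 x] by (simp_all add: numeral_3_eq_3)

lemma scaled_harm_reflect:
  assumes "j + k + 1 = m"
  shows "pdvd 3 (scaled_harm m k 1 + scaled_harm m j 1 + scaled_harm m j 2 + scaled_harm m j 3)"
    and "pdvd 3 (scaled_harm m k 2 - scaled_harm m j 2 - 2 * scaled_harm m j 3)"
    and "pdvd 3 (scaled_harm m k 3 + scaled_harm m j 3)"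
proof -
  have dvd: "m dvd j + k + 1"
    using assms by simp
  show "pdvd 3 (scaled_harm m k 1 + scaled_harm m j 1 + scaled_harm m j 2 + scaled_harm m j 3)"
    using partial_harm_reflect(1) [OF dvd] by (simp add: scaled_harm_def)
  show "pdvd 3 (scaled_harm m k 2 - scaled_harm m j 2 - 2 * scaled_harm m j 3)"
    using pdvd_3_mult(1) [OF partial_harm_reflect(2) [OF dvd]]
    by (simp add: scaled_harm_def algebra_simps power2_eq_square)
  show "pdvd 3 (scaled_harm m k 3 + scaled_harm m j 3)"
    using pdvd_3_mult(2) [OF partial_harm_reflect(3) [OF dvd]]
    by (simp add: scaled_harm_def algebra_simps)
qed

lemma scaled_harm_refine:
  assumes "d > 0" "e > 0" "\<not> p dvd e"
  shows "scaled_harm d j s = (\<Sum>i<e. scaled_harm (d * e) (j + d * i) s)"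
  by (simp add: scaled_harm_def partial_harm_refine [OF assms] sum_distrib_left)

lemma log_quotient_scaled_harm:
  assumes "m > 0" "\<not> p dvd m"
  shows "pdvd 3 (log_quotient m - (\<Sum>j<m. of_nat j * scaled_harm m j 1
    - of_nat j ^ 2 / 2 * scaled_harm m j 2 + of_nat j ^ 3 / 3 * scaled_harm m j 3))"
  using log_quotient_eq [OF assms] by (simp add: scaled_harm_def)

lemma scaled_harm_relation:
  assumes "m > 0" "\<not> p dvd m"
  shows "pdvd 3 ((1 / of_nat m ^ 2 - 1) * scaled_harm 1 0 2 + 2 * (\<Sum>j<m. of_nat j * scaled_harm m j 3))"
  using pdvd_3_mult(1) [OF harm_2_relation [OF assms]]
  by (simp add: scaled_harm_def algebra_simps power2_eq_square sum_distrib_left)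

lemma scaled_harm_bernoulli: "pdvd 3 (scaled_harm 1 0 2 - 2 / 3 * P ^ 2 * bernoulli (p - 3))"
  using pdvd_3_mult(1) [OF harm_2_bernoulli]
  by (simp add: scaled_harm_def algebra_simps power2_eq_square)

lemma hyp_sum_scaled_harm:
  assumes m: "m > 1" "\<not> p dvd m" and mod: "p mod m = 1 \<or> p mod m = m - 1"
  shows "pdvd 3 (hyp_sum (p - 1) (- 1 / of_nat m) -
    (2 * of_nat m * scaled_harm m (m - 1) 1 + 2 * of_nat m * (of_nat m - 1) * scaled_harm m (m - 1) 3
      + scaled_harm 1 0 2 / of_nat m))"
proof -
  have "hyp_sum (p - 1) (- of_nat (p mod m) / of_nat m) = hyp_sum (p - 1) (- 1 / of_nat m)"
    using mod
  proof
    assume r: "p mod m = m - 1"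
    have "- of_nat (p mod m) / of_nat m = - 1 - (- 1 / of_nat m :: rat)"
      unfolding r using m(1) by (simp add: of_nat_diff field_simps)
    then show ?thesis by (simp only: hyp_sum_reflect)
  qed simp
  moreover have "\<not> m dvd p"
    using m(1) mod by (auto simp: dvd_eq_mod_eq_0)
  ultimately show ?thesis
    using hyp_sum_cong [of m] m by (simp add: scaled_harm_def)
qed

section \<open>Elimination for m = 3, 4, 6\<close>

lemma not_dvd_small: "\<not> p dvd 2" "\<not> p dvd 3" "\<not> p dvd 4" "\<not> p dvd 6"
proof -
  show 2: "\<not> p dvd 2" and 3: "\<not> p dvd 3"
    using p_gt_3 by (auto dest: dvd_imp_le)
  show "\<not> p dvd 4"
    using 2 prime_dvd_mult_iff [OF prime_p, of 2 2] by simp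
  show "\<not> p dvd 6"
    using 2 3 prime_dvd_mult_iff [OF prime_p, of 2 3] by simp
qed

lemma p_mod_small:
  shows "p mod 3 = 1 \<or> p mod 3 = 3 - 1" "p mod 4 = 1 \<or> p mod 4 = 4 - 1" "p mod 6 = 1 \<or> p mod 6 = 6 - 1"
proof -
  have "prime (3 :: nat)" by simp
  then have *: "\<not> 2 dvd p" "\<not> 3 dvd p"
    using prime_p p_gt_3 primes_dvd_imp_eq [of 2 p] primes_dvd_imp_eq [of 3 p] by auto
  then show "p mod 3 = 1 \<or> p mod 3 = 3 - 1" "p mod 4 = 1 \<or> p mod 4 = 4 - 1"
    by presburger+
  show "p mod 6 = 1 \<or> p mod 6 = 6 - 1"
    using * by presburger
qed

lemma lessThan_small: "{..<2 :: nat} = {0, 1}" "{..<3 :: nat} = {0, 1, 2}" "{..<4 :: nat} = {0, 1, 2, 3}"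
  "{..<6 :: nat} = {0, 1, 2, 3, 4, 5}"
  by auto

text \<open>In the following three proofs the coefficients of the final linear combination solve the
  linear system that eliminates the sums \<open>a j\<close>, \<open>b j\<close>, \<open>c j\<close>.\<close>

lemma hyp_sum_third: "pdvd 3 (hyp_sum (p - 1) (- 1 / 3) - (3 * log_quotient 3 + 26 / 9 * scaled_harm 1 0 2))"
proof -
  define h where "h = scaled_harm 1 0 2"
  define a b c where "a j = scaled_harm 3 j 1" and "b j = scaled_harm 3 j 2" and "c j = scaled_harm 3 j 3" for j
  note defs = h_def a_def b_def c_def
  define f where "f = hyp_sum (p - 1) (- 1 / 3)"
  define L3 where "L3 = log_quotient 3"
  have F: "pdvd 3 (f - (6 * a 2 + 12 * c 2 + h / 3))"
    using hyp_sum_scaled_harm [OF _ not_dvd_small(2) p_mod_small(1)] by (simp add: f_def defs)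
  have h: "h = b 0 + b 1 + b 2"
    using scaled_harm_refine [of 1 3 0 2] not_dvd_small(2) by (simp add: defs lessThan_small)
  have R0: "pdvd 3 (a 2 + a 0 + b 0 + c 0)" "pdvd 3 (b 2 - b 0 - 2 * c 0)" "pdvd 3 (c 2 + c 0)"
    using scaled_harm_reflect [of 0 2 3] by (simp_all add: defs)
  \<comment> \<open>Class 1 is its own reflection modulo 3, so the second relation just says that c
    1 vanishes up to a unit.\<close>
  have R1: "pdvd 3 (a 1 + a 1 + b 1 + c 1)" "pdvd 3 (b 1 - b 1 - 2 * c 1)"
    unfolding defs by (rule scaled_harm_reflect; simp)+
  have Q3: "pdvd 3 (L3 - ((a 1 - b 1 / 2 + c 1 / 3) + ((2 * a 2 - 4 * b 2 / 2 + 8 * c 2 / 3))))"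
    using log_quotient_scaled_harm [OF _ not_dvd_small(2)] by (simp add: L3_def defs lessThan_small)
  have H3: "pdvd 3 ((1 / 9 - 1) * h + 2 * (c 1 + (2 * c 2)))"
    using scaled_harm_relation [OF _ not_dvd_small(2)] by (simp add: defs lessThan_small)
  \<comment> \<open>The factor 4, a unit at p, makes all coefficients integers, so each term is a
    numeral times a known multiple of p^3.\<close>
  have "4 * (f - (3 * L3 + 26 / 9 * h)) = 4 * (f - (6 * a 2 + 12 * c 2 + h / 3))
    + 12 * (b 2 - b 0 - 2 * c 0)
    + 24 * (c 2 + c 0)
    - 6 * (a 1 + a 1 + b 1 + c 1)
    - 3 * (b 1 - b 1 - 2 * c 1)
    - 12 * (L3 - ((a 1 - b 1 / 2 + c 1 / 3) + ((2 * a 2 - 4 * b 2 / 2 + 8 * c 2 / 3))))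
    - 2 * ((1 / 9 - 1) * h + 2 * (c 1 + (2 * c 2)))"
    unfolding h by (simp add: field_simps)
  also have "pdvd 3 \<dots>"
    by (intro pdvd_add pdvd_diff pdvd_mult_left [OF pdvd_numeral(1)] F R0 R1 Q3 H3)
  finally show ?thesis
    unfolding f_def L3_def h_def by (rule punit_cancel [OF punit_of_nat [of 4, simplified, OF not_dvd_small(3)]])
qed

lemma hyp_sum_fourth: "pdvd 3 (hyp_sum (p - 1) (- 1 / 4) - (6 * log_quotient 2 + 21 / 4 * scaled_harm 1 0 2))"
proof -
  define h where "h = scaled_harm 1 0 2"
  define a b c where "a j = scaled_harm 4 j 1" and "b j = scaled_harm 4 j 2" and "c j = scaled_harm 4 j 3" for j
  note defs = h_def a_def b_def c_def
  define f where "f = hyp_sum (p - 1) (- 1 / 4)"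
  define L2 where "L2 = log_quotient 2"
  have F: "pdvd 3 (f - (8 * a 3 + 24 * c 3 + h / 4))"
    using hyp_sum_scaled_harm [OF _ not_dvd_small(3) p_mod_small(2)] by (simp add: f_def defs)
  have h: "h = b 0 + b 1 + b 2 + b 3"
    using scaled_harm_refine [of 1 4 0 2] not_dvd_small(3) by (simp add: defs lessThan_small)
  have R0: "pdvd 3 (a 3 + a 0 + b 0 + c 0)" "pdvd 3 (b 3 - b 0 - 2 * c 0)" "pdvd 3 (c 3 + c 0)"
    using scaled_harm_reflect [of 0 3 4] by (simp_all add: defs)
  have R1: "pdvd 3 (a 2 + a 1 + b 1 + c 1)" "pdvd 3 (b 2 - b 1 - 2 * c 1)" "pdvd 3 (c 2 + c 1)"
    using scaled_harm_reflect [of 1 2 4] by (simp_all add: defs)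
  \<comment> \<open>The relations for the divisor 2 are rewritten in the classes modulo 4, so that
    all relations share the same unknowns.\<close>
  have refine2: "scaled_harm 2 j s = scaled_harm 4 j s + scaled_harm 4 (j + 2) s" for j s
    using scaled_harm_refine [of 2 2 j s] not_dvd_small(1) by (simp add: lessThan_small)
  have Q2: "pdvd 3 (L2 - (((a 1 + a 3) - (b 1 + b 3) / 2 + (c 1 + c 3) / 3)))"
    using log_quotient_scaled_harm [OF _ not_dvd_small(1)] by (simp add: L2_def defs refine2 lessThan_small flip: numeral_3_eq_3)
  have H2: "pdvd 3 ((1 / 4 - 1) * h + 2 * ((c 1 + c 3)))"
    using scaled_harm_relation [OF _ not_dvd_small(1)] by (simp add: defs refine2 lessThan_small flip: numeral_3_eq_3)
  have "pdvd 3 (log_quotient 4 - ((a 1 - b 1 / 2 + c 1 / 3) + ((2 * a 2 - 4 * b 2 / 2 + 8 * c 2 / 3)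
        + ((3 * a 3 - 9 * b 3 / 2 + 27 * c 3 / 3)))))"
    using log_quotient_scaled_harm [OF _ not_dvd_small(3)] by (simp add: defs lessThan_small)
  \<comment> \<open>Additivity replaces the logarithm of 4 by twice that of 2, so this second
    relation brings in no new constant.\<close>
  from pdvd_diff [OF this log_quotient_mult [of 2 2]]
  have Q4: "pdvd 3 ((2 * L2) - ((a 1 - b 1 / 2 + c 1 / 3) + ((2 * a 2 - 4 * b 2 / 2 + 8 * c 2 / 3)
        + ((3 * a 3 - 9 * b 3 / 2 + 27 * c 3 / 3)))))"
    using not_dvd_small by (simp add: L2_def algebra_simps)
  have H4: "pdvd 3 ((1 / 16 - 1) * h + 2 * (c 1 + (2 * c 2 + (3 * c 3))))"
    using scaled_harm_relation [OF _ not_dvd_small(3)] by (simp add: defs lessThan_small)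
  have "3 * (f - (6 * L2 + 21 / 4 * h)) = 3 * (f - (8 * a 3 + 24 * c 3 + h / 4))
    + 15 * (b 3 - b 0 - 2 * c 0)
    + 30 * (c 3 + c 0)
    - 12 * (a 2 + a 1 + b 1 + c 1)
    - 3 * (b 2 - b 1 - 2 * c 1)
    - 6 * (L2 - (((a 1 + a 3) - (b 1 + b 3) / 2 + (c 1 + c 3) / 3)))
    + 5 * ((1 / 4 - 1) * h + 2 * ((c 1 + c 3)))
    - 6 * ((2 * L2) - ((a 1 - b 1 / 2 + c 1 / 3) + ((2 * a 2 - 4 * b 2 / 2 + 8 * c 2 / 3) + ((3 * a 3 - 9 * b 3 / 2 + 27 * c 3 / 3)))))
    - 4 * ((1 / 16 - 1) * h + 2 * (c 1 + (2 * c 2 + (3 * c 3))))"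
    unfolding h by (simp add: field_simps)
  also have "pdvd 3 \<dots>"
    by (intro pdvd_add pdvd_diff pdvd_mult_left [OF pdvd_numeral(1)] F R0 R1 Q2 H2 Q4 H4)
  finally show ?thesis
    unfolding f_def L2_def h_def by (rule punit_cancel [OF punit_2_3(2)])
qed

lemma hyp_sum_sixth: "pdvd 3 (hyp_sum (p - 1) (- 1 / 6) - (4 * log_quotient 2 + 3 * log_quotient 3 + 455 / 36 * scaled_harm 1 0 2))"
proof -
  define h where "h = scaled_harm 1 0 2"
  define a b c where "a j = scaled_harm 6 j 1" and "b j = scaled_harm 6 j 2" and "c j = scaled_harm 6 j 3" for j
  note defs = h_def a_def b_def c_def
  define f where "f = hyp_sum (p - 1) (- 1 / 6)"
  define L2 where "L2 = log_quotient 2"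
  define L3 where "L3 = log_quotient 3"
  have F: "pdvd 3 (f - (12 * a 5 + 60 * c 5 + h / 6))"
    using hyp_sum_scaled_harm [OF _ not_dvd_small(4) p_mod_small(3)] by (simp add: f_def defs)
  have h: "h = b 0 + b 1 + b 2 + b 3 + b 4 + b 5"
    using scaled_harm_refine [of 1 6 0 2] not_dvd_small(4) by (simp add: defs lessThan_small)
  have R0: "pdvd 3 (a 5 + a 0 + b 0 + c 0)" "pdvd 3 (b 5 - b 0 - 2 * c 0)" "pdvd 3 (c 5 + c 0)"
    using scaled_harm_reflect [of 0 5 6] by (simp_all add: defs)
  have R1: "pdvd 3 (a 4 + a 1 + b 1 + c 1)" "pdvd 3 (b 4 - b 1 - 2 * c 1)" "pdvd 3 (c 4 + c 1)"
    using scaled_harm_reflect [of 1 4 6] by (simp_all add: defs)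
  have R2: "pdvd 3 (a 3 + a 2 + b 2 + c 2)" "pdvd 3 (b 3 - b 2 - 2 * c 2)" "pdvd 3 (c 3 + c 2)"
    using scaled_harm_reflect [of 2 3 6] by (simp_all add: defs)
  have refine2: "scaled_harm 2 j s = scaled_harm 6 j s + scaled_harm 6 (j + 2) s + scaled_harm 6 (j + 4) s" for j s
    using scaled_harm_refine [of 2 3 j s] not_dvd_small(2) by (simp add: lessThan_small)
  have Q2: "pdvd 3 (L2 - (((a 1 + a 3 + a 5) - (b 1 + b 3 + b 5) / 2 + (c 1 + c 3 + c 5) / 3)))"
    using log_quotient_scaled_harm [OF _ not_dvd_small(1)] by (simp add: L2_def defs refine2 lessThan_small flip: numeral_3_eq_3)
  have H2: "pdvd 3 ((1 / 4 - 1) * h + 2 * ((c 1 + c 3 + c 5)))"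
    using scaled_harm_relation [OF _ not_dvd_small(1)] by (simp add: defs refine2 lessThan_small flip: numeral_3_eq_3)
  have refine3: "scaled_harm 3 j s = scaled_harm 6 j s + scaled_harm 6 (j + 3) s" for j s
    using scaled_harm_refine [of 3 2 j s] not_dvd_small(1) by (simp add: lessThan_small)
  have Q3: "pdvd 3 (L3 - (((a 1 + a 4) - (b 1 + b 4) / 2 + (c 1 + c 4) / 3) + ((2 * (a 2 + a 5) - 4 * (b 2 + b 5) / 2 + 8 * (c 2 + c 5) / 3))))"
    using log_quotient_scaled_harm [OF _ not_dvd_small(2)] by (simp add: L3_def defs refine3 lessThan_small flip: numeral_3_eq_3)
  have H3: "pdvd 3 ((1 / 9 - 1) * h + 2 * ((c 1 + c 4) + (2 * (c 2 + c 5))))"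
    using scaled_harm_relation [OF _ not_dvd_small(2)] by (simp add: defs refine3 lessThan_small flip: numeral_3_eq_3)
  have "pdvd 3 (log_quotient 6 - ((a 1 - b 1 / 2 + c 1 / 3) + ((2 * a 2 - 4 * b 2 / 2 + 8 * c 2 / 3)
        + ((3 * a 3 - 9 * b 3 / 2 + 27 * c 3 / 3) + ((4 * a 4 - 16 * b 4 / 2 + 64 * c 4 / 3)
        + ((5 * a 5 - 25 * b 5 / 2 + 125 * c 5 / 3)))))))"
    using log_quotient_scaled_harm [OF _ not_dvd_small(4)] by (simp add: defs lessThan_small)
  from pdvd_diff [OF this log_quotient_mult [of 2 3]]
  have Q6: "pdvd 3 ((L2 + L3) - ((a 1 - b 1 / 2 + c 1 / 3) + ((2 * a 2 - 4 * b 2 / 2 + 8 * c 2 / 3)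
        + ((3 * a 3 - 9 * b 3 / 2 + 27 * c 3 / 3) + ((4 * a 4 - 16 * b 4 / 2 + 64 * c 4 / 3)
        + ((5 * a 5 - 25 * b 5 / 2 + 125 * c 5 / 3)))))))"
    using not_dvd_small by (simp add: L2_def L3_def algebra_simps)
  have H6: "pdvd 3 ((1 / 36 - 1) * h + 2 * (c 1 + (2 * c 2 + (3 * c 3 + (4 * c 4 + (5 * c 5))))))"
    using scaled_harm_relation [OF _ not_dvd_small(4)] by (simp add: defs lessThan_small)
  have "2 * (f - (4 * L2 + 3 * L3 + 455 / 36 * h)) = 2 * (f - (12 * a 5 + 60 * c 5 + h / 6))
    + 18 * (b 5 - b 0 - 2 * c 0)
    + 36 * (c 5 + c 0)
    - 12 * (a 4 + a 1 + b 1 + c 1)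
    - 12 * (c 4 + c 1)
    - 12 * (a 3 + a 2 + b 2 + c 2)
    - 6 * (b 3 - b 2 - 2 * c 2)
    - 12 * (c 3 + c 2)
    - 6 * (L2 - (((a 1 + a 3 + a 5) - (b 1 + b 3 + b 5) / 2 + (c 1 + c 3 + c 5) / 3)))
    + 11 * ((1 / 4 - 1) * h + 2 * ((c 1 + c 3 + c 5)))
    - 4 * (L3 - (((a 1 + a 4) - (b 1 + b 4) / 2 + (c 1 + c 4) / 3) + ((2 * (a 2 + a 5) - 4 * (b 2 + b 5) / 2 + 8 * (c 2 + c 5) / 3))))
    + 4 * ((1 / 9 - 1) * h + 2 * ((c 1 + c 4) + (2 * (c 2 + c 5))))
    - 2 * ((L2 + L3) - ((a 1 - b 1 / 2 + c 1 / 3) + ((2 * a 2 - 4 * b 2 / 2 + 8 * c 2 / 3)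
        + ((3 * a 3 - 9 * b 3 / 2 + 27 * c 3 / 3) + ((4 * a 4 - 16 * b 4 / 2 + 64 * c 4 / 3)
        + ((5 * a 5 - 25 * b 5 / 2 + 125 * c 5 / 3)))))))
    - 5 * ((1 / 36 - 1) * h + 2 * (c 1 + (2 * c 2 + (3 * c 3 + (4 * c 4 + (5 * c 5))))))"
    unfolding h by (simp add: field_simps)
  also have "pdvd 3 \<dots>"
    by (intro pdvd_add pdvd_diff pdvd_mult_left [OF pdvd_numeral(1)] F R0 R1 R2 Q2 H2 Q3 H3 Q6 H6)
  finally show ?thesis
    unfolding f_def L2_def L3_def h_def by (rule punit_cancel [OF punit_2_3(1)])
qed

section \<open>Return to Fermat quotients and Bernoulli numbers\<close>

lemma log_quotient_fermat:
  "log_quotient m = fermat_quotient p (int m) - P * fermat_quotient p (int m) ^ 2 / 2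
    + P ^ 2 * fermat_quotient p (int m) ^ 3 / 3"
proof -
  have "of_nat m ^ (p - 1) - 1 = P * fermat_quotient p (int m)"
    by (simp add: fermat_quotient_def)
  then show ?thesis
    by (simp add: log_quotient_def ln3_def power_mult_distrib field_simps power2_eq_square power3_eq_cube)
qed

lemma pdvd_fermat_quotient:
  assumes "m > 0" "\<not> p dvd m"
  shows "pdvd 0 (fermat_quotient p (int m))"
  using fermat_little [OF assms] by (simp add: fermat_quotient_def pdvd_def)

text \<open>Integrality of x is inherited from y and x - y, so it need not be checked on the
  binomial sums themselves.\<close>

lemma rat_congI:
  assumes "pdvd 0 y" "pdvd m (x - y)"
  shows "rat_cong p m x y"
proof -
  have "pdvd 0 (y + (x - y))"
    by (intro pdvd_add assms(1) pdvd_mono [OF assms(2)]) simp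
  then show ?thesis
    using assms by (simp add: rat_cong_def pdvd_def)
qed

end

theorem theorem5p2:
  fixes p :: nat
  assumes "prime p" and "p > 3"
  shows
    "rat_cong p 3
       (\<Sum>k = 1..p - 1. of_nat (((2 * k) choose k) * ((3 * k) choose k)) / (27 ^ k * of_nat k))
       (3 * fermat_quotient p 3
        - 3 / 2 * of_nat p * fermat_quotient p 3 ^ 2
        + of_nat p ^ 2 * fermat_quotient p 3 ^ 3
        + 52 / 27 * of_nat p ^ 2 * bernoulli (p - 3)) \<and>
     rat_cong p 3
       (\<Sum>k = 1..p - 1. of_nat (((2 * k) choose k) * ((4 * k) choose (2 * k))) / (64 ^ k * of_nat k))
       (6 * fermat_quotient p 2
        - 3 * of_nat p * fermat_quotient p 2 ^ 2
        + 2 * of_nat p ^ 2 * fermat_quotient p 2 ^ 3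
        + 7 / 2 * of_nat p ^ 2 * bernoulli (p - 3)) \<and>
     rat_cong p 3
       (\<Sum>k = 1..p - 1. of_nat (((6 * k) choose (3 * k)) * ((3 * k) choose k)) / (432 ^ k * of_nat k))
       (4 * fermat_quotient p 2 + 3 * fermat_quotient p 3
        - of_nat p * (2 * fermat_quotient p 2 ^ 2 + 3 / 2 * fermat_quotient p 3 ^ 2)
        + of_nat p ^ 2 * (4 / 3 * fermat_quotient p 2 ^ 3 + fermat_quotient p 3 ^ 3)
        + 455 / 54 * of_nat p ^ 2 * bernoulli (p - 3))"
proof -
  interpret prime_gt_3 p
    using assms by unfold_locales
  define q2 q3 B where "q2 = fermat_quotient p 2" and "q3 = fermat_quotient p 3" and "B = bernoulli (p - 3)"
  define h where "h = scaled_harm 1 0 2"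
  have int: "pdvd 0 q2" "pdvd 0 q3" "pdvd 0 B" "pdvd 0 P"
    using pdvd_fermat_quotient [of 2] pdvd_fermat_quotient [of 3] not_dvd_small pdvd_bernoulli [of "p - 3"] p_gt_3
    by (auto simp: q2_def q3_def B_def)
  have L: "log_quotient 2 = q2 - P * q2 ^ 2 / 2 + P ^ 2 * q2 ^ 3 / 3"
      "log_quotient 3 = q3 - P * q3 ^ 2 / 2 + P ^ 2 * q3 ^ 3 / 3"
    using log_quotient_fermat [of 2] log_quotient_fermat [of 3] by (simp_all add: q2_def q3_def)
  have h: "pdvd 3 (h - 2 / 3 * P ^ 2 * B)"
    using scaled_harm_bernoulli by (simp add: h_def B_def)
  have frac: "pdvd 0 (n / 2)" "pdvd 0 (n / 3)" "pdvd 0 (n / 27)" "pdvd 0 (n / 54)" if "pdvd 0 n" for n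
    using pdvd_divide [OF that punit_2_3(1)] pdvd_divide [OF that punit_2_3(2)]
      pdvd_divide [OF that punit_power [OF punit_2_3(2), of 3]]
      pdvd_divide [OF that punit_mult [OF punit_2_3(1) punit_power [OF punit_2_3(2), of 3]]]
    by simp_all
  have u: "punit 9" "punit 4" "punit 36"
    using punit_power [OF punit_2_3(2), of 2] punit_power [OF punit_2_3(1), of 2]
      punit_power [OF punit_mult [OF punit_2_3], of 2] by simp_all
  show ?thesis
    unfolding q2_def [symmetric] q3_def [symmetric] B_def [symmetric]
  proof (intro conjI)
    show "rat_cong p 3
       (\<Sum>k = 1..p - 1. of_nat (((2 * k) choose k) * ((3 * k) choose k)) / (27 ^ k * of_nat k))
       (3 * q3 - 3 / 2 * P * q3 ^ 2 + P ^ 2 * q3 ^ 3 + 52 / 27 * P ^ 2 * B)" (is "rat_cong p 3 ?x ?y")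
    proof (rule rat_congI)
      have x: "?x = hyp_sum (p - 1) (- 1 / 3)"
        unfolding hyp_sum_def binomial_prod_3 [symmetric] by simp
      show "pdvd 0 ?y"
        using int by (intro pdvd_add pdvd_diff pdvd_mult_left pdvd_power0 frac) auto
      \<comment> \<open>Replacing h by 2/3 p^2 B turns 26/9 into the coefficient 52/27; in the other
        two parts 21/4 becomes 7/2 and 455/36 becomes 455/54. The leading unit clears the
        denominator.\<close>
      have "9 * (?x - ?y) = 9 * (hyp_sum (p - 1) (- 1 / 3) - (3 * log_quotient 3 + 26 / 9 * h)) + 26 * (h - 2 / 3 * P ^ 2 * B)"
        unfolding x L by (simp add: algebra_simps)
      also have "pdvd 3 \<dots>"
        unfolding h_def by (intro pdvd_add pdvd_mult_left [OF pdvd_numeral(1)] hyp_sum_third h [unfolded h_def])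
      finally show "pdvd 3 (?x - ?y)"
        by (rule punit_cancel [OF u(1)])
    qed
    show "rat_cong p 3
       (\<Sum>k = 1..p - 1. of_nat (((2 * k) choose k) * ((4 * k) choose (2 * k))) / (64 ^ k * of_nat k))
       (6 * q2 - 3 * P * q2 ^ 2 + 2 * P ^ 2 * q2 ^ 3 + 7 / 2 * P ^ 2 * B)" (is "rat_cong p 3 ?x ?y")
    proof (rule rat_congI)
      have x: "?x = hyp_sum (p - 1) (- 1 / 4)"
        unfolding hyp_sum_def binomial_prod_4 [symmetric] by simp
      show "pdvd 0 ?y"
        using int by (intro pdvd_add pdvd_diff pdvd_mult_left pdvd_power0 frac) auto
      have "4 * (?x - ?y) = 4 * (hyp_sum (p - 1) (- 1 / 4) - (6 * log_quotient 2 + 21 / 4 * h)) + 21 * (h - 2 / 3 * P ^ 2 * B)"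
        unfolding x L by (simp add: algebra_simps)
      also have "pdvd 3 \<dots>"
        unfolding h_def by (intro pdvd_add pdvd_mult_left [OF pdvd_numeral(1)] hyp_sum_fourth h [unfolded h_def])
      finally show "pdvd 3 (?x - ?y)"
        by (rule punit_cancel [OF u(2)])
    qed
    show "rat_cong p 3
       (\<Sum>k = 1..p - 1. of_nat (((6 * k) choose (3 * k)) * ((3 * k) choose k)) / (432 ^ k * of_nat k))
       (4 * q2 + 3 * q3 - P * (2 * q2 ^ 2 + 3 / 2 * q3 ^ 2) + P ^ 2 * (4 / 3 * q2 ^ 3 + q3 ^ 3)
        + 455 / 54 * P ^ 2 * B)" (is "rat_cong p 3 ?x ?y")
    proof (rule rat_congI)
      have x: "?x = hyp_sum (p - 1) (- 1 / 6)"
        unfolding hyp_sum_def binomial_prod_6 [symmetric] by simp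
      show "pdvd 0 ?y"
        using int by (intro pdvd_add pdvd_diff pdvd_mult_left pdvd_power0 frac) auto
      have "36 * (?x - ?y) = 36 * (hyp_sum (p - 1) (- 1 / 6) - (4 * log_quotient 2 + 3 * log_quotient 3 + 455 / 36 * h))
          + 455 * (h - 2 / 3 * P ^ 2 * B)"
        unfolding x L by (simp add: algebra_simps)
      also have "pdvd 3 \<dots>"
        unfolding h_def by (intro pdvd_add pdvd_mult_left [OF pdvd_numeral(1)] hyp_sum_sixth h [unfolded h_def])
      finally show "pdvd 3 (?x - ?y)"
        by (rule punit_cancel [OF u(3)])
    qed
  qed
qed

end
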